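(* For any real separable Hilbert space $J$ and any $\alpha\in(0,1)$, $$C^\alpha_b(H,J)\subset\big(C_b(H,J),C^1_K(H,J)\big)_{\alpha,\infty}$$ with a continuous inclusion.
   Context: Setting. $U$ is a real separable Hilbert space and $\Lambda:\mathcal D(\Lambda)\subset U\to U$ is a positive self-adjoint operator ($\langle \Lambda u,u\rangle_U\ge m|u|_U^2$ for some $m>0$) whose inverse $\Lambda^{-1}$ is a trace class operator on $U$. $V=\mathcal D(\Lambda^{1/2})$ with $\langle h,k\rangle_V=\langle\Lambda^{1/2}h,\Lambda^{1/2}k\rangle_U$; $V'$ is its dual, identified with the completion of $U$ in the norm $|\Lambda^{-1/2}\cdot|_U$, with inner product $\langle\Lambda^{-1/2}\cdot,\Lambda^{-1/2}\cdot\rangle_U$. Put $H=U\times V'$ and $K=V\times U\subset H$ with the product Hilbert structures. $C_b(H,J)$ is the space of bounded uniformly continuous functions $H\to J$ with sup norm. $C^\alpha_b(H,J)$ is the space of $f\in C_b(H,J)$ with $[f]_\alpha=\sup_{x\neq x'}|f(x)-f(x')|_J|x-x'|_H^{-\alpha}<\infty$, with norm $\|f\|_\infty+[f]_\alpha$. A map $F:H\to J$ is $K$-differentiable on $H$ if for all $x\in H$, $k\in K$ the limit $\nabla_kF(x)=\lim_{s\to0}\frac{F(x+sk)-F(x)}s$ exists in $J$ and $\nabla^KF(x):k\mapsto\nabla_kF(x)$ belongs to $L(K,J)$. $C^1_K(H,J)$ is the space of $f\in C_b(H,J)$ that are $K$-differentiable on $H$ with $\nabla^Kf:H\to L(K,J)$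 uniformly continuous and bounded (uniform continuity with respect to the norm of $H$), with norm $\|f\|_\infty+\|\nabla^Kf\|_\infty$. Real interpolation space: $f\in(C_b(H,J),C^1_K(H,J))_{\alpha,\infty}$ iff $f\in C_b(H,J)$ and $\sup_{t\in(0,1]}t^{-\alpha}L(t,f)<\infty$ (this supremum being the norm), where $L(t,f)=\inf\{\|a\|_{C_b(H,J)}+t\|b\|_{C^1_K(H,J)}:f=a+b,\ a\in C_b(H,J),\ b\in C^1_K(H,J)\}$. *)

theory Defs
  imports "HOL-Analysis.Analysis"
begin

section \<open>Operators on a real Hilbert space\<close>

text \<open>
  A (possibly unbounded) operator is a pair of its domain \<^term>\<open>D\<close> and a function whose values
  outside \<^term>\<open>D\<close> are irrelevant.
\<close>

definition linear_op :: "'a::real_vector set \<Rightarrow> ('a \<Rightarrow> 'b::real_vector) \<Rightarrow> bool" where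
  "linear_op D A \<longleftrightarrow> subspace D \<and>
     (\<forall>x\<in>D. \<forall>y\<in>D. A (x + y) = A x + A y) \<and> (\<forall>c. \<forall>x\<in>D. A (c *\<^sub>R x) = c *\<^sub>R A x)"

text \<open>
  The last conjunct says that the graph of the adjoint (left of the equivalence) is the graph of
  the operator itself, so it includes the equality of the two domains.
\<close>

definition self_adjoint_op :: "'a::real_inner set \<Rightarrow> ('a \<Rightarrow> 'a) \<Rightarrow> bool" where
  "self_adjoint_op D A \<longleftrightarrow> linear_op D A \<and> closure D = UNIV \<and>
     (\<forall>u w. (\<forall>v\<in>D. A v \<bullet> u = v \<bullet> w) \<longleftrightarrow> (u \<in> D \<and> A u = w))"

text \<open>
  \<^term>\<open>S\<close> with domain \<^term>\<open>V\<close> is the square root of \<^term>\<open>A\<close> with domain \<^term>\<open>D\<close>: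
  the nonnegative self-adjoint operator with square \<^term>\<open>A\<close>, where the domain of the square
  is the natural one.
\<close>

definition is_op_sqrt ::
  "'a::real_inner set \<Rightarrow> ('a \<Rightarrow> 'a) \<Rightarrow> 'a set \<Rightarrow> ('a \<Rightarrow> 'a) \<Rightarrow> bool" where
  "is_op_sqrt V S D A \<longleftrightarrow> self_adjoint_op V S \<and> (\<forall>u\<in>V. S u \<bullet> u \<ge> 0) \<and>
     D = {u \<in> V. S u \<in> V} \<and> (\<forall>u\<in>D. A u = S (S u))"

text \<open>Trace class (nuclear) operators, in terms of a nuclear representation.\<close>

definition trace_class_op :: "('a::real_inner \<Rightarrow> 'a) \<Rightarrow> bool" where
  "trace_class_op T \<longleftrightarrow> (\<exists>a b. summable (\<lambda>n::nat. norm (a n) * norm (b n)) \<and>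
     (\<forall>x. (\<lambda>n. (a n \<bullet> x) *\<^sub>R b n) sums T x))"

text \<open>
  \<^term>\<open>\<iota>\<close> exhibits the Hilbert space \<^typ>\<open>'w\<close> as the completion of \<^typ>\<open>'u\<close>
  with respect to the inner product \<^term>\<open>ip\<close>.
\<close>

definition is_completion ::
  "('u::real_vector \<Rightarrow> 'u \<Rightarrow> real) \<Rightarrow> ('u \<Rightarrow> 'w::{real_inner, complete_space}) \<Rightarrow> bool" where
  "is_completion ip \<iota> \<longleftrightarrow> linear \<iota> \<and> (\<forall>u v. \<iota> u \<bullet> \<iota> v = ip u v) \<and> closure (range \<iota>) = UNIV"


section \<open>Function spaces on the product space\<close>

text \<open>
  The space \<open>H\<close> is the product type \<^typ>\<open>'u \<times> 'w\<close>, whose library norm is the Hilbert product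
  norm. An element of \<open>K\<close> is a pair \<^term>\<open>(v, u)\<close> in \<^term>\<open>V \<times> (UNIV :: 'u set)\<close>,
  which \<^term>\<open>\<iota>\<close> embeds into \<open>H\<close> as \<^term>\<open>(v, \<iota> u)\<close>.
\<close>

definition K_space :: "'u set \<Rightarrow> ('u \<times> 'u) set" where
  "K_space V = V \<times> UNIV"

definition K_norm :: "('u::real_normed_vector \<Rightarrow> 'u) \<Rightarrow> 'u \<times> 'u \<Rightarrow> real" where
  "K_norm S k = sqrt ((norm (S (fst k)))\<^sup>2 + (norm (snd k))\<^sup>2)"

definition K_emb :: "('u \<Rightarrow> 'w) \<Rightarrow> 'u \<times> 'u \<Rightarrow> 'u \<times> 'w" where
  "K_emb \<iota> k = (fst k, \<iota> (snd k))"

definition K_bounded_linear ::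
  "'u::real_normed_vector set \<Rightarrow> ('u \<Rightarrow> 'u) \<Rightarrow> ('u \<times> 'u \<Rightarrow> 'j::real_normed_vector) \<Rightarrow> bool" where
  "K_bounded_linear V S T \<longleftrightarrow> linear_op (K_space V) T \<and>
     (\<exists>C. \<forall>k \<in> K_space V. norm (T k) \<le> C * K_norm S k)"

definition K_opnorm ::
  "'u::real_normed_vector set \<Rightarrow> ('u \<Rightarrow> 'u) \<Rightarrow> ('u \<times> 'u \<Rightarrow> 'j::real_normed_vector) \<Rightarrow> real" where
  "K_opnorm V S T = (SUP k \<in> {k \<in> K_space V. K_norm S k \<le> 1}. norm (T k))"

definition Cb :: "('h::metric_space \<Rightarrow> 'j::real_normed_vector) set" where
  "Cb = {f. bounded (range f) \<and> uniformly_continuous_on UNIV f}"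

definition sup_norm :: "('h \<Rightarrow> 'j::real_normed_vector) \<Rightarrow> real" where
  "sup_norm f = (SUP x. norm (f x))"

text \<open>
  Diagonal pairs contribute \<open>0 / 0 = 0\<close>, so they do not change the supremum.
\<close>

definition holder_quot :: "real \<Rightarrow> ('h::metric_space \<Rightarrow> 'j::real_normed_vector) \<Rightarrow> 'h \<times> 'h \<Rightarrow> real" where
  "holder_quot \<alpha> f p = norm (f (fst p) - f (snd p)) / dist (fst p) (snd p) powr \<alpha>"

definition Cb_holder :: "real \<Rightarrow> ('h::metric_space \<Rightarrow> 'j::real_normed_vector) set" where
  "Cb_holder \<alpha> = {f \<in> Cb. bdd_above (range (holder_quot \<alpha> f))}"

definition holder_norm :: "real \<Rightarrow> ('h::metric_space \<Rightarrow> 'j::real_normed_vector) \<Rightarrow> real" where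
  "holder_norm \<alpha> f = sup_norm f + (SUP p. holder_quot \<alpha> f p)"

definition K_quot ::
  "('u \<Rightarrow> 'w) \<Rightarrow> ('u::real_normed_vector \<times> 'w::real_normed_vector \<Rightarrow> 'j::real_normed_vector)
     \<Rightarrow> 'u \<times> 'w \<Rightarrow> 'u \<times> 'u \<Rightarrow> real \<Rightarrow> 'j" where
  "K_quot \<iota> F x k s = (F (x + s *\<^sub>R K_emb \<iota> k) - F x) /\<^sub>R s"

definition K_grad ::
  "('u \<Rightarrow> 'w) \<Rightarrow> ('u::real_normed_vector \<times> 'w::real_normed_vector \<Rightarrow> 'j::real_normed_vector)
     \<Rightarrow> 'u \<times> 'w \<Rightarrow> 'u \<times> 'u \<Rightarrow> 'j" where
  "K_grad \<iota> F x k = Lim (at 0) (K_quot \<iota> F x k)"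

definition K_differentiable ::
  "'u set \<Rightarrow> ('u \<Rightarrow> 'u) \<Rightarrow> ('u \<Rightarrow> 'w)
     \<Rightarrow> ('u::real_normed_vector \<times> 'w::real_normed_vector \<Rightarrow> 'j::real_normed_vector) \<Rightarrow> bool" where
  "K_differentiable V S \<iota> F \<longleftrightarrow>
     (\<forall>x. (\<forall>k \<in> K_space V. \<exists>l. (K_quot \<iota> F x k \<longlongrightarrow> l) (at 0)) \<and>
          K_bounded_linear V S (K_grad \<iota> F x))"

definition C1K ::
  "'u set \<Rightarrow> ('u \<Rightarrow> 'u) \<Rightarrow> ('u \<Rightarrow> 'w)
     \<Rightarrow> ('u::real_normed_vector \<times> 'w::real_normed_vector \<Rightarrow> 'j::real_normed_vector) set" where
  "C1K V S \<iota> = {F \<in> Cb. K_differentiable V S \<iota> F \<and>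
     bdd_above (range (\<lambda>x. K_opnorm V S (K_grad \<iota> F x))) \<and>
     (\<forall>\<epsilon>>0. \<exists>\<delta>>0. \<forall>x y. dist x y < \<delta> \<longrightarrow>
        K_opnorm V S (\<lambda>k. K_grad \<iota> F x k - K_grad \<iota> F y k) < \<epsilon>)}"

definition C1K_norm ::
  "'u set \<Rightarrow> ('u \<Rightarrow> 'u) \<Rightarrow> ('u \<Rightarrow> 'w)
     \<Rightarrow> ('u::real_normed_vector \<times> 'w::real_normed_vector \<Rightarrow> 'j::real_normed_vector) \<Rightarrow> real" where
  "C1K_norm V S \<iota> F = sup_norm F + (SUP x. K_opnorm V S (K_grad \<iota> F x))"

definition interp_L ::
  "'u set \<Rightarrow> ('u \<Rightarrow> 'u) \<Rightarrow> ('u \<Rightarrow> 'w) \<Rightarrow> real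
     \<Rightarrow> ('u::real_normed_vector \<times> 'w::real_normed_vector \<Rightarrow> 'j::real_normed_vector) \<Rightarrow> real" where
  "interp_L V S \<iota> t f =
     Inf {sup_norm a + t * C1K_norm V S \<iota> b | a b.
            f = (\<lambda>x. a x + b x) \<and> a \<in> Cb \<and> b \<in> C1K V S \<iota>}"

definition interp_space ::
  "'u set \<Rightarrow> ('u \<Rightarrow> 'u) \<Rightarrow> ('u \<Rightarrow> 'w) \<Rightarrow> real
     \<Rightarrow> ('u::real_normed_vector \<times> 'w::real_normed_vector \<Rightarrow> 'j::real_normed_vector) set" where
  "interp_space V S \<iota> \<alpha> =
     {f \<in> Cb. bdd_above ((\<lambda>t. t powr (-\<alpha>) * interp_L V S \<iota> t f) ` {0<..1})}"

definition interp_norm ::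
  "'u set \<Rightarrow> ('u \<Rightarrow> 'u) \<Rightarrow> ('u \<Rightarrow> 'w) \<Rightarrow> real
     \<Rightarrow> ('u::real_normed_vector \<times> 'w::real_normed_vector \<Rightarrow> 'j::real_normed_vector) \<Rightarrow> real" where
  "interp_norm V S \<iota> \<alpha> f = (SUP t \<in> {0<..1}. t powr (-\<alpha>) * interp_L V S \<iota> t f)"

definition continuously_included ::
  "'f set \<Rightarrow> ('f \<Rightarrow> real) \<Rightarrow> 'f set \<Rightarrow> ('f \<Rightarrow> real) \<Rightarrow> bool" where
  "continuously_included X nX Y nY \<longleftrightarrow> X \<subseteq> Y \<and> (\<exists>C. \<forall>f\<in>X. nY f \<le> C * nX f)"

end

theory Submission
  imports Defs "HOL-Probability.Probability"
begin

text \<open>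
  Since \<open>\<Lambda>\<^sup>-\<^sup>1\<close> is trace class, \<open>\<Lambda>\<^sup>-\<^sup>1\<^sup>/\<^sup>2\<close> is Hilbert--Schmidt, and therefore so is the embedding
  of \<open>K\<close> in \<open>H\<close>: the image \<open>e\<close> in \<open>H\<close> of an orthonormal basis of \<open>K\<close> is square summable. For
  independent standard Gaussians \<open>\<omega>\<close> put \<open>Y = \<Sum>i. \<omega> i e i\<close> and smooth \<open>f\<close> to
  \<open>b x = E f (x + t Y)\<close>. Hoelder continuity of \<open>f\<close> gives \<open>\<parallel>f - b\<parallel> \<le> C t\<^sup>\<alpha>\<close>. By the Cameron--Martin
  formula \<open>b\<close> is differentiable along \<open>K\<close> with derivative
  \<open>k \<mapsto> t\<^sup>-\<^sup>1 E (f (x + t Y) (\<Sum>i. \<omega> i k i))\<close>, where \<open>f (x + t Y)\<close> may be replaced by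
  \<open>f (x + t Y) - f x\<close>, so that the derivative is bounded by \<open>C t\<^sup>\<alpha>\<^sup>-\<^sup>1\<close>. To avoid the convergence of the
  series \<open>Y\<close>, everything is done for its partial sums, with bounds independent of their length, and
  the smoothed functions are then shown to converge uniformly.
\<close>

section \<open>Independent standard Gaussian variables\<close>

text \<open>The same \<open>t\<close> must serve both summands: a displacement of size
  \<open>t\<close> costs \<open>t powr \<alpha>\<close> in the sup norm, a derivative costs a
  further factor \<open>1 / t\<close>, and the weight \<open>t\<close> in \<open>interp_L\<close>
  returns it. Only second moments of the displacement enter. At unit scale this moment is \<sigma>,
  which for the frame chosen at the end is twice the trace of the inverse of \<Lambda>; through
  \<open>u powr \<alpha> \<le> 1 + u^2\<close> it controls the Hoelder moments, so that the
  embedding constant \<open>2 * (1 + \<sigma>)\<close> does not depend on \<alpha>. The obstacle is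
  that a vector of K need not be a finite combination of the \<open>e i\<close>, while smoothing in
  \<open>n\<close> directions regularizes along the first \<open>n\<close> of them only. The way out
  is a first-order expansion with a quadratic remainder that depends on the direction only through
  the sum of its squared coordinates, hence through its K norm; it allows the limits in the step
  size and in \<open>n\<close> to be exchanged. Uniform continuity of the gradient costs no further
  derivative: the Gaussian factor does not involve \<open>x\<close>, so a difference of gradients
  falls on \<open>f\<close> alone.\<close>

definition gauss :: "real measure" where
  "gauss = density lborel std_normal_density"

definition gauss_seq :: "(nat \<Rightarrow> real) measure" where
  "gauss_seq = PiM UNIV (\<lambda>_. gauss)"

lemma prob_space_gauss: "prob_space gauss"
  unfolding gauss_def by (rule prob_space_normal_density) simp

lemma prob_space_gauss_seq: "prob_space gauss_seq"
  unfolding gauss_seq_def by (intro prob_space_PiM prob_space_gauss)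

interpretation gauss: prob_space gauss by (rule prob_space_gauss)
interpretation gauss_seq: prob_space gauss_seq by (rule prob_space_gauss_seq)
interpretation gauss_pair: pair_sigma_finite gauss gauss_seq ..

lemma sets_gauss [measurable_cong, simp]: "sets gauss = sets borel"
  by (simp add: gauss_def)

lemma space_gauss [simp]: "space gauss = UNIV"
  by (simp add: gauss_def)

lemma sets_gauss_seq [measurable_cong]: "sets gauss_seq = sets (PiM UNIV (\<lambda>_. borel))"
  unfolding gauss_seq_def by (rule sets_PiM_cong) auto

lemma space_gauss_seq [simp]: "space gauss_seq = UNIV"
  by (simp add: gauss_seq_def space_PiM)

lemma measure_gauss_seq [simp]: "measure gauss_seq UNIV = 1"
  using gauss_seq.prob_space by simp

text \<open>Translation invariance of Lebesgue measure and completing the square in the exponent.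
  The nonnegative integral keeps the later iteration over coordinates free of integrability
  conditions.\<close>

lemma nn_integral_gauss_shift:
  assumes [measurable]: "F \<in> borel_measurable borel"
  shows "(\<integral>\<^sup>+x. F (x + h) \<partial>gauss) = (\<integral>\<^sup>+x. ennreal (exp (h * x - h\<^sup>2 / 2)) * F x \<partial>gauss)"
proof -
  have dens: "std_normal_density (x - h) = std_normal_density x * exp (h * x - h\<^sup>2 / 2)" for x
    by (simp add: std_normal_density_def exp_add [symmetric] power2_eq_square field_simps)
  have "(\<integral>\<^sup>+x. F (x + h) \<partial>gauss) = (\<integral>\<^sup>+x. ennreal (std_normal_density x) * F (x + h) \<partial>lborel)"
    unfolding gauss_def by (subst nn_integral_density) auto
  also have "\<dots> = (\<integral>\<^sup>+x. ennreal (std_normal_density (x - h)) * F x \<partial>lborel)"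
    by (subst nn_integral_real_affine[where c = 1 and t = "-h"]) (auto simp: algebra_simps)
  also have "\<dots> = (\<integral>\<^sup>+x. ennreal (std_normal_density x) * (ennreal (exp (h * x - h\<^sup>2 / 2)) * F x) \<partial>lborel)"
    by (simp add: dens ennreal_mult mult.assoc)
  also have "\<dots> = (\<integral>\<^sup>+x. ennreal (exp (h * x - h\<^sup>2 / 2)) * F x \<partial>gauss)"
    unfolding gauss_def by (subst nn_integral_density) auto
  finally show ?thesis .
qed

lemma measurable_upd [measurable]:
  "(\<lambda>(x, \<omega>). fun_upd \<omega> i x) \<in> measurable (gauss \<Otimes>\<^sub>M gauss_seq) gauss_seq"
proof -
  have "(\<lambda>(x, \<omega>). fun_upd \<omega> i x) \<in> measurable (borel \<Otimes>\<^sub>M PiM UNIV (\<lambda>_. borel)) (PiM UNIV (\<lambda>_::nat. borel :: real measure))"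
    by (rule measurable_PiM_single') (auto simp: case_prod_beta space_PiM fun_upd_def)
  then show ?thesis
    by (simp cong: measurable_cong_sets add: sets_gauss_seq sets_pair_measure_cong[OF sets_gauss sets_gauss_seq])
qed

text \<open>Replacing one coordinate by an independent copy preserves the law. This isolates a
  coordinate as a factor of a binary product, where Fubini applies.\<close>

lemma gauss_seq_resample:
  "distr (gauss \<Otimes>\<^sub>M gauss_seq) gauss_seq (\<lambda>(x, \<omega>). fun_upd \<omega> i x) = gauss_seq"
  using distr_pair_PiM_eq_PiM[of UNIV "\<lambda>_. gauss" i] prob_space_gauss
  by (simp add: gauss_seq_def)

lemma nn_integral_gauss_seq_coord:
  assumes [measurable]: "F \<in> borel_measurable gauss_seq"
  shows "(\<integral>\<^sup>+\<omega>. F \<omega> \<partial>gauss_seq) = (\<integral>\<^sup>+\<omega>. (\<integral>\<^sup>+x. F (fun_upd \<omega> i x) \<partial>gauss) \<partial>gauss_seq)"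
proof -
  have "(\<integral>\<^sup>+\<omega>. F \<omega> \<partial>gauss_seq) = (\<integral>\<^sup>+p. F (case p of (x, \<omega>) \<Rightarrow> fun_upd \<omega> i x) \<partial>(gauss \<Otimes>\<^sub>M gauss_seq))"
    by (subst gauss_seq_resample[of i, symmetric], subst nn_integral_distr) auto
  also have "\<dots> = (\<integral>\<^sup>+\<omega>. (\<integral>\<^sup>+x. F (fun_upd \<omega> i x) \<partial>gauss) \<partial>gauss_seq)"
    by (subst gauss_pair.nn_integral_snd[symmetric]) auto
  finally show ?thesis .
qed

lemma borel_measurable_upd:
  assumes "F \<in> borel_measurable gauss_seq"
  shows "(\<lambda>x. F (fun_upd \<omega> i x)) \<in> borel_measurable borel"
proof -
  have "(\<lambda>x. fun_upd \<omega> i x) \<in> measurable borel (PiM UNIV (\<lambda>_::nat. borel :: real measure))"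
    by (rule measurable_PiM_single') (auto simp: space_PiM fun_upd_def)
  then have "(\<lambda>x. fun_upd \<omega> i x) \<in> measurable borel gauss_seq"
    by (simp cong: measurable_cong_sets add: sets_gauss_seq)
  from measurable_compose[OF this assms] show ?thesis .
qed

section \<open>Cameron-Martin formula for shifts of finitely many coordinates\<close>

definition shift :: "nat \<Rightarrow> (nat \<Rightarrow> real) \<Rightarrow> (nat \<Rightarrow> real) \<Rightarrow> nat \<Rightarrow> real" where
  "shift n h \<omega> = (\<lambda>i. if i < n then \<omega> i + h i else \<omega> i)"

text \<open>The Cameron--Martin density of the law of the shifted sequence.\<close>

definition cm_density :: "nat \<Rightarrow> (nat \<Rightarrow> real) \<Rightarrow> (nat \<Rightarrow> real) \<Rightarrow> real" where
  "cm_density n h \<omega> = exp ((\<Sum>i<n. \<omega> i * h i) - (\<Sum>i<n. (h i)\<^sup>2) / 2)"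

lemma measurable_shift [measurable]: "shift n h \<in> measurable gauss_seq gauss_seq"
proof -
  have "shift n h \<in> measurable gauss_seq (PiM UNIV (\<lambda>_::nat. borel :: real measure))"
    by (rule measurable_PiM_single') (auto simp: space_PiM shift_def)
  then show ?thesis
    by (simp cong: measurable_cong_sets add: sets_gauss_seq)
qed

lemma measurable_cm_density [measurable]: "cm_density n h \<in> borel_measurable gauss_seq"
  unfolding cm_density_def by measurable

text \<open>Induction on the number of shifted coordinates: coordinate \<open>n\<close> is
  resampled, the one-dimensional formula turns its shift into an exponential weight, and the
  weighted function \<open>G\<close> is handed to the induction hypothesis.\<close>

lemma nn_integral_shift:
  assumes "F \<in> borel_measurable gauss_seq"
  shows "(\<integral>\<^sup>+\<omega>. F (shift n h \<omega>) \<partial>gauss_seq) = (\<integral>\<^sup>+\<omega>. ennreal (cm_density n h \<omega>) * F \<omega> \<partial>gauss_seq)"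
  using assms
proof (induction n arbitrary: F)
  case 0
  then show ?case by (simp add: shift_def cm_density_def)
next
  case (Suc n)
  note [measurable] = Suc.prems
  define G where "G \<omega> = ennreal (exp (h n * \<omega> n - (h n)\<^sup>2 / 2)) * F \<omega>" for \<omega>
  have [measurable]: "G \<in> borel_measurable gauss_seq"
    unfolding G_def by measurable
  have upd: "shift (Suc n) h (fun_upd \<omega> n x) = fun_upd (shift n h \<omega>) n (x + h n)" for \<omega> x
    by (auto simp: shift_def fun_eq_iff)
  have upd': "shift n h (fun_upd \<omega> n x) = fun_upd (shift n h \<omega>) n (x)" for \<omega> x
    by (auto simp: shift_def fun_eq_iff)
  have "(\<integral>\<^sup>+\<omega>. F (shift (Suc n) h \<omega>) \<partial>gauss_seq)
      = (\<integral>\<^sup>+\<omega>. (\<integral>\<^sup>+x. F (fun_upd (shift n h \<omega>) n (x + h n)) \<partial>gauss) \<partial>gauss_seq)"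
    by (subst nn_integral_gauss_seq_coord[of _ n]) (auto simp: upd)
  also have "\<dots> = (\<integral>\<^sup>+\<omega>. (\<integral>\<^sup>+x. G (fun_upd (shift n h \<omega>) n (x)) \<partial>gauss) \<partial>gauss_seq)"
    unfolding G_def
    by (subst nn_integral_gauss_shift[OF borel_measurable_upd]) (auto simp: Suc.prems)
  also have "\<dots> = (\<integral>\<^sup>+\<omega>. G (shift n h \<omega>) \<partial>gauss_seq)"
    by (subst (2) nn_integral_gauss_seq_coord[of _ n]) (auto simp: upd')
  also have "\<dots> = (\<integral>\<^sup>+\<omega>. ennreal (cm_density n h \<omega>) * G \<omega> \<partial>gauss_seq)"
    by (rule Suc.IH) simp
  also have "\<dots> = (\<integral>\<^sup>+\<omega>. ennreal (cm_density (Suc n) h \<omega>) * F \<omega> \<partial>gauss_seq)"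
    unfolding G_def cm_density_def
    by (simp add: mult.assoc[symmetric] ennreal_mult[symmetric] exp_add[symmetric] algebra_simps add_divide_distrib diff_divide_distrib)
  finally show ?case .
qed

text \<open>As an identity of measures the formula transfers to integrals of signed functions,
  integrability included.\<close>

lemma distr_shift: "distr gauss_seq gauss_seq (shift n h) = density gauss_seq (cm_density n h)"
proof (rule measure_eqI)
  fix A assume "A \<in> sets (distr gauss_seq gauss_seq (shift n h))"
  then have [measurable]: "A \<in> sets gauss_seq" by simp
  have "emeasure (distr gauss_seq gauss_seq (shift n h)) A
     = (\<integral>\<^sup>+\<omega>. indicator A \<omega> \<partial>distr gauss_seq gauss_seq (shift n h))"
    by simp
  also have "\<dots> = (\<integral>\<^sup>+\<omega>. indicator A (shift n h \<omega>) \<partial>gauss_seq)"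
    by (rule nn_integral_distr) auto
  also have "\<dots> = (\<integral>\<^sup>+\<omega>. ennreal (cm_density n h \<omega>) * indicator A \<omega> \<partial>gauss_seq)"
    by (rule nn_integral_shift) auto
  also have "\<dots> = emeasure (density gauss_seq (cm_density n h)) A"
    by (simp add: emeasure_density)
  finally show "emeasure (distr gauss_seq gauss_seq (shift n h)) A
     = emeasure (density gauss_seq (cm_density n h)) A" .
qed simp

lemma
  fixes F :: "(nat \<Rightarrow> real) \<Rightarrow> real"
  assumes [measurable]: "F \<in> borel_measurable gauss_seq"
  shows integrable_shift_iff:
      "integrable gauss_seq (\<lambda>\<omega>. cm_density n h \<omega> * F \<omega>) \<longleftrightarrow> integrable gauss_seq (\<lambda>\<omega>. F (shift n h \<omega>))"
    and integral_shift:
      "(\<integral>\<omega>. F (shift n h \<omega>) \<partial>gauss_seq) = (\<integral>\<omega>. cm_density n h \<omega> * F \<omega> \<partial>gauss_seq)"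
proof -
  have nn: "AE \<omega> in gauss_seq. 0 \<le> cm_density n h \<omega>"
    by (simp add: cm_density_def)
  show "integrable gauss_seq (\<lambda>\<omega>. cm_density n h \<omega> * F \<omega>) \<longleftrightarrow> integrable gauss_seq (\<lambda>\<omega>. F (shift n h \<omega>))"
    using integrable_density[of F gauss_seq "cm_density n h"] nn
      integrable_distr_eq[of "shift n h" gauss_seq gauss_seq F]
    by (simp add: distr_shift)
  show "(\<integral>\<omega>. F (shift n h \<omega>) \<partial>gauss_seq) = (\<integral>\<omega>. cm_density n h \<omega> * F \<omega> \<partial>gauss_seq)"
    using integral_density[of F gauss_seq "cm_density n h"] nn
      integral_distr[of "shift n h" gauss_seq gauss_seq F]
    by (simp add: distr_shift)
qed

section \<open>Moments of the coordinates and covariances of finite Gaussian sums\<close>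

lemma distr_gauss_coord: "distr gauss_seq gauss (\<lambda>\<omega>. \<omega> i) = gauss"
  unfolding gauss_seq_def by (rule distr_PiM_component) (auto intro: prob_space_gauss)

lemma
  shows integrable_coord_power: "integrable gauss_seq (\<lambda>\<omega>. \<omega> i ^ k)"
    and integral_coord_power: "(\<integral>\<omega>. \<omega> i ^ k \<partial>gauss_seq) = (\<integral>x. std_normal_density x * x ^ k \<partial>lborel)"
proof -
  have [measurable]: "(\<lambda>x. x ^ k) \<in> borel_measurable gauss"
    by (simp add: gauss_def)
  have eq: "integrable gauss (\<lambda>x. x ^ k) \<longleftrightarrow> integrable lborel (\<lambda>x. std_normal_density x * x ^ k)"
      "(\<integral>x. x ^ k \<partial>gauss) = (\<integral>x. std_normal_density x * x ^ k \<partial>lborel)"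
    unfolding gauss_def by (subst integrable_density integral_density; simp)+
  show "integrable gauss_seq (\<lambda>\<omega>. \<omega> i ^ k)"
    using integrable_distr_eq[of "\<lambda>\<omega>. \<omega> i" gauss_seq gauss "\<lambda>x. x ^ k"] eq integrable_std_normal_moment
    by (simp add: distr_gauss_coord)
  show "(\<integral>\<omega>. \<omega> i ^ k \<partial>gauss_seq) = (\<integral>x. std_normal_density x * x ^ k \<partial>lborel)"
    using integral_distr[of "\<lambda>\<omega>. \<omega> i" gauss_seq gauss "\<lambda>x. x ^ k"] eq
    by (simp add: distr_gauss_coord)
qed

lemma
  shows integrable_coord: "integrable gauss_seq (\<lambda>\<omega>. \<omega> i)"
    and integral_coord: "(\<integral>\<omega>. \<omega> i \<partial>gauss_seq) = 0"
  using integrable_coord_power[of i 1] integral_coord_power[of i 1] integral_std_normal_moment_odd[of 0]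
  by simp_all

lemma
  shows integrable_coord_mult: "integrable gauss_seq (\<lambda>\<omega>. \<omega> i * \<omega> j)"
    and integral_coord_mult: "(\<integral>\<omega>. \<omega> i * \<omega> j \<partial>gauss_seq) = (if i = j then 1 else 0)"
proof -
  show int: "integrable gauss_seq (\<lambda>\<omega>. \<omega> i * \<omega> j)" for i j
  proof (rule Bochner_Integration.integrable_bound)
    show "integrable gauss_seq (\<lambda>\<omega>. (\<omega> i)\<^sup>2 + (\<omega> j)\<^sup>2)"
      by (intro Bochner_Integration.integrable_add integrable_coord_power)
    have "\<bar>a * b\<bar> \<le> a\<^sup>2 + b\<^sup>2" for a b :: real
      using sum_squares_bound[of "\<bar>a\<bar>" "\<bar>b\<bar>"] mult_nonneg_nonneg[of "\<bar>a\<bar>" "\<bar>b\<bar>"]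
      unfolding abs_mult power2_abs by linarith
    then show "AE \<omega> in gauss_seq. norm (\<omega> i * \<omega> j) \<le> norm ((\<omega> i)\<^sup>2 + (\<omega> j)\<^sup>2)"
      by simp
  qed simp
  show "(\<integral>\<omega>. \<omega> i * \<omega> j \<partial>gauss_seq) = (if i = j then 1 else 0)"
  proof (cases "i = j")
    case True
    then show ?thesis
      using integral_coord_power[of i 2] integral_std_normal_moment_even[of 1]
      by (simp add: power2_eq_square)
  next
    \<comment> \<open>Resampling coordinate \<open>i\<close> makes \<open>\<omega> i\<close> and
      \<open>\<omega> j\<close> functions of different factors of a product measure, so the mean of
      the product vanishes with the mean of \<open>\<omega> j\<close>.\<close>
    case False
    let ?f = "\<lambda>(x, \<omega>). x * \<omega> j"
    have eq: "(\<lambda>p. (case p of (x, \<omega>) \<Rightarrow> fun_upd \<omega> i x) i * (case p of (x, \<omega>) \<Rightarrow> fun_upd \<omega> i x) j) = ?f"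
      using False by (auto simp: fun_eq_iff)
    have int': "integrable (gauss \<Otimes>\<^sub>M gauss_seq) ?f"
      using int[of i j] integrable_distr_eq[of "\<lambda>(x, \<omega>). fun_upd \<omega> i x" "gauss \<Otimes>\<^sub>M gauss_seq" gauss_seq "\<lambda>\<omega>. \<omega> i * \<omega> j"]
      unfolding eq gauss_seq_resample by simp
    have "(\<integral>\<omega>. \<omega> i * \<omega> j \<partial>gauss_seq) = (\<integral>p. ?f p \<partial>(gauss \<Otimes>\<^sub>M gauss_seq))"
      using integral_distr[of "\<lambda>(x, \<omega>). fun_upd \<omega> i x" "gauss \<Otimes>\<^sub>M gauss_seq" gauss_seq "\<lambda>\<omega>. \<omega> i * \<omega> j"]
      unfolding eq gauss_seq_resample by simp
    also have "\<dots> = (\<integral>x. (\<integral>\<omega>. x * \<omega> j \<partial>gauss_seq) \<partial>gauss)"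
      using gauss_pair.integral_fst'[OF int'] by simp
    also have "\<dots> = 0"
      by (simp add: integral_coord)
    finally show ?thesis using False by simp
  qed
qed

text \<open>Used in two roles: with vectors \<open>e i\<close> it is the random displacement, with
  real numbers \<open>h i\<close> it is the Gaussian functional that multiplies \<open>f\<close> in
  the derivative.\<close>

definition gsum :: "nat \<Rightarrow> (nat \<Rightarrow> 'h::real_vector) \<Rightarrow> (nat \<Rightarrow> real) \<Rightarrow> 'h" where
  "gsum n v \<omega> = (\<Sum>i<n. \<omega> i *\<^sub>R v i)"

lemma measurable_gsum [measurable]:
  fixes v :: "nat \<Rightarrow> 'h::{real_normed_vector, second_countable_topology}"
  shows "gsum n v \<in> borel_measurable gauss_seq"
  unfolding gsum_def by measurable

lemma
  fixes v w :: "nat \<Rightarrow> 'h::real_inner"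
  shows integrable_gsum_inner: "integrable gauss_seq (\<lambda>\<omega>. gsum n v \<omega> \<bullet> gsum n w \<omega>)"
    and integral_gsum_inner: "(\<integral>\<omega>. gsum n v \<omega> \<bullet> gsum n w \<omega> \<partial>gauss_seq) = (\<Sum>i<n. v i \<bullet> w i)"
proof -
  have eq: "gsum n v \<omega> \<bullet> gsum n w \<omega> = (\<Sum>i<n. \<Sum>j<n. (\<omega> i * \<omega> j) * (v i \<bullet> w j))" for \<omega>
    unfolding gsum_def by (subst inner_sum_left) (simp add: inner_sum_right sum_distrib_left ac_simps)
  show "integrable gauss_seq (\<lambda>\<omega>. gsum n v \<omega> \<bullet> gsum n w \<omega>)"
    unfolding eq
    by (intro Bochner_Integration.integrable_sum integrable_mult_left integrable_coord_mult)
  have "(\<integral>\<omega>. gsum n v \<omega> \<bullet> gsum n w \<omega> \<partial>gauss_seq)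
      = (\<Sum>i<n. \<Sum>j<n. (\<integral>\<omega>. (\<omega> i * \<omega> j) * (v i \<bullet> w j) \<partial>gauss_seq))"
    unfolding eq
    by (simp add: Bochner_Integration.integral_sum Bochner_Integration.integrable_sum integrable_coord_mult)
  also have "\<dots> = (\<Sum>i<n. \<Sum>j<n. (if i = j then v i \<bullet> w j else 0))"
    by (intro sum.cong refl) (simp add: integral_coord_mult)
  also have "\<dots> = (\<Sum>i<n. v i \<bullet> w i)"
    by (intro sum.cong refl) (simp add: sum.delta)
  finally show "(\<integral>\<omega>. gsum n v \<omega> \<bullet> gsum n w \<omega> \<partial>gauss_seq) = (\<Sum>i<n. v i \<bullet> w i)" .
qed


section \<open>Orthonormal bases of separable Hilbert spaces\<close>

text \<open>
  Zero vectors are allowed, so that finite-dimensional spaces also have a basis indexed by the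
  natural numbers.
\<close>

definition orthonormal0 :: "(nat \<Rightarrow> 'a::real_inner) \<Rightarrow> bool" where
  "orthonormal0 g \<longleftrightarrow> (\<forall>i j. i \<noteq> j \<longrightarrow> g i \<bullet> g j = 0) \<and> (\<forall>i. g i = 0 \<or> g i \<bullet> g i = 1)"

text \<open>Since \<open>sgn 0 = 0\<close>, a vector dependent on its predecessors yields zero and
  the recursion goes on; this is where zero vectors enter a basis.\<close>

function gram_schmidt :: "(nat \<Rightarrow> 'a::real_inner) \<Rightarrow> nat \<Rightarrow> 'a" where
  "gram_schmidt d n = sgn (d n - (\<Sum>i<n. (d n \<bullet> gram_schmidt d i) *\<^sub>R gram_schmidt d i))"
  by auto
termination by (relation "inv_image less_than snd") auto

declare gram_schmidt.simps [simp del]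

lemma inner_sgn_self: "sgn x = 0 \<or> sgn x \<bullet> sgn x = (1::real)" for x :: "'a::real_inner"
  by (cases "x = 0") (simp_all add: norm_sgn flip: power2_norm_eq_inner)

lemma orthonormal0_gram_schmidt: "orthonormal0 (gram_schmidt d)"
proof -
  let ?g = "gram_schmidt d"
  have self: "?g i = 0 \<or> ?g i \<bullet> ?g i = 1" for i
    by (subst (1 2 3) gram_schmidt.simps) (rule inner_sgn_self)
  have "\<forall>i<j. ?g j \<bullet> ?g i = 0" for j
  proof (induction j rule: less_induct)
    case (less j)
    show ?case
    proof (intro allI impI)
      fix i assume i: "i < j"
      \<comment> \<open>Only \<open>l = i\<close> survives. Its factor
        \<open>?g i \<bullet> ?g i\<close> is 1 unless \<open>?g i = 0\<close>, and then both sides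
        vanish.\<close>
      have "(\<Sum>l<j. (d j \<bullet> ?g l) * (?g l \<bullet> ?g i)) = (\<Sum>l<j. if l = i then d j \<bullet> ?g i else 0)"
      proof (intro sum.cong refl)
        fix l assume "l \<in> {..<j}"
        then have "?g l \<bullet> ?g i = 0" if "l \<noteq> i"
          using less.IH[of l] less.IH[of i] i that by (metis inner_commute lessThan_iff linorder_neqE_nat)
        then show "(d j \<bullet> ?g l) * (?g l \<bullet> ?g i) = (if l = i then d j \<bullet> ?g i else 0)"
          using self[of i] by auto
      qed
      then show "?g j \<bullet> ?g i = 0"
        using i by (subst gram_schmidt.simps)
          (simp add: sgn_div_norm inner_diff_left inner_sum_left)
    qed
  qed
  then show ?thesis
    using self unfolding orthonormal0_def by (metis inner_commute linorder_neqE_nat)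
qed

lemma span_gram_schmidt: "d n \<in> span (range (gram_schmidt d))"
proof -
  let ?g = "gram_schmidt d"
  let ?s = "\<Sum>i<n. (d n \<bullet> ?g i) *\<^sub>R ?g i"
  have "norm z *\<^sub>R sgn z = z" for z :: 'a
    by (cases "z = 0") (simp_all add: sgn_div_norm)
  from this[of "d n - ?s"] have "d n = norm (d n - ?s) *\<^sub>R ?g n + ?s"
    by (simp flip: gram_schmidt.simps[of d n])
  also have "\<dots> \<in> span (range ?g)"
    by (intro span_add span_scale span_sum span_base) auto
  finally show ?thesis .
qed

lemma gram_schmidt_in_span: "gram_schmidt d n \<in> span (range d)"
proof (induction n rule: less_induct)
  case (less n)
  show ?case
    by (subst gram_schmidt.simps, unfold sgn_div_norm)
      (intro span_scale span_diff span_sum; auto intro: less.IH span_base)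
qed

text \<open>Gram-Schmidt applied to a dense sequence of \<open>R\<close>. The two inclusions make
  \<open>g\<close> a basis of \<open>R\<close> itself when \<open>R\<close> is a closed subspace,
  not merely a family spanning something larger.\<close>

lemma ex_orthonormal0:
  fixes R :: "'a::{real_inner, second_countable_topology} set"
  assumes "R \<noteq> {}"
  obtains g where "orthonormal0 g" "range g \<subseteq> span R" "R \<subseteq> closure (span (range g))"
proof -
  obtain T where T: "countable T" "T \<subseteq> R" "R \<subseteq> closure T"
    by (rule separable)
  with assms have "T \<noteq> {}" by auto
  with T obtain d :: "nat \<Rightarrow> 'a" where d: "range d = T"
    by (metis uncountable_def)
  show ?thesis
  proof
    show "orthonormal0 (gram_schmidt d)" by (rule orthonormal0_gram_schmidt)
    show "range (gram_schmidt d) \<subseteq> span R"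
      using gram_schmidt_in_span[of d] d T(2) span_mono[of T R] by auto
    have "T \<subseteq> span (range (gram_schmidt d))"
      using span_gram_schmidt[of d] d by auto
    then show "R \<subseteq> closure (span (range (gram_schmidt d)))"
      using T(3) closure_mono by blast
  qed
qed

section \<open>Finite orthonormal sums and Bessel's inequality\<close>

context
  fixes g :: "nat \<Rightarrow> 'a::real_inner"
  assumes g: "orthonormal0 g"
begin

lemma orthonormal0_inner_sum:
  assumes "finite A"
  shows "(\<Sum>i\<in>A. c i *\<^sub>R g i) \<bullet> g j = (if j \<in> A then c j * (g j \<bullet> g j) else 0)"
proof -
  have "(\<Sum>i\<in>A. c i *\<^sub>R g i) \<bullet> g j = (\<Sum>i\<in>A. if i = j then c j * (g j \<bullet> g j) else 0)"
    unfolding inner_sum_left using g by (intro sum.cong) (auto simp: orthonormal0_def)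
  then show ?thesis using assms by (simp add: sum.delta)
qed

lemma orthonormal0_inner_le_1: "g i \<bullet> g i \<le> 1"
  using g unfolding orthonormal0_def by (metis inner_zero_left less_eq_real_def zero_less_one)

lemma orthonormal0_inner_scale: "(x \<bullet> g i) * (g i \<bullet> g i) = x \<bullet> g i"
  using g unfolding orthonormal0_def by (metis inner_zero_right mult.right_neutral mult_zero_left)

text \<open>Only an inequality, because a coefficient at a zero vector is lost on the left.\<close>

lemma orthonormal0_norm_sum:
  assumes "finite A"
  shows "(norm (\<Sum>i\<in>A. c i *\<^sub>R g i))\<^sup>2 \<le> (\<Sum>i\<in>A. (c i)\<^sup>2)"
proof -
  have "(norm (\<Sum>i\<in>A. c i *\<^sub>R g i))\<^sup>2 = (\<Sum>j\<in>A. (c j)\<^sup>2 * (g j \<bullet> g j))"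
    unfolding power2_norm_eq_inner
    by (subst inner_sum_right) (simp add: orthonormal0_inner_sum[OF assms] power2_eq_square mult.assoc)
  also have "\<dots> \<le> (\<Sum>i\<in>A. (c i)\<^sup>2)"
    by (intro sum_mono mult_left_le orthonormal0_inner_le_1) simp
  finally show ?thesis .
qed

lemma orthonormal0_bessel_finite: "(\<Sum>i<n. (x \<bullet> g i)\<^sup>2) \<le> (norm x)\<^sup>2"
proof -
  let ?s = "\<Sum>i<n. (x \<bullet> g i) *\<^sub>R g i"
  have xs: "x \<bullet> ?s = (\<Sum>i<n. (x \<bullet> g i)\<^sup>2)"
    by (simp add: inner_sum_right power2_eq_square)
  have ss: "?s \<bullet> ?s = (\<Sum>i<n. (x \<bullet> g i)\<^sup>2)"
    by (subst inner_sum_right)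
      (simp add: orthonormal0_inner_sum orthonormal0_inner_scale power2_eq_square)
  have "0 \<le> (x - ?s) \<bullet> (x - ?s)"
    by simp
  also have "\<dots> = (norm x)\<^sup>2 - (\<Sum>i<n. (x \<bullet> g i)\<^sup>2)"
    unfolding inner_diff_left inner_diff_right ss inner_commute[of ?s x] xs power2_norm_eq_inner by simp
  finally show ?thesis by simp
qed

lemma
  shows orthonormal0_bessel_summable: "summable (\<lambda>i. (x \<bullet> g i)\<^sup>2)"
    and orthonormal0_bessel: "(\<Sum>i. (x \<bullet> g i)\<^sup>2) \<le> (norm x)\<^sup>2"
proof -
  show "summable (\<lambda>i. (x \<bullet> g i)\<^sup>2)"
  proof (rule bounded_imp_summable)
    show "(\<Sum>i\<le>n. (x \<bullet> g i)\<^sup>2) \<le> (norm x)\<^sup>2" for n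
      using orthonormal0_bessel_finite[of x "Suc n"] unfolding lessThan_Suc_atMost .
  qed simp
  then show "(\<Sum>i. (x \<bullet> g i)\<^sup>2) \<le> (norm x)\<^sup>2"
    by (rule suminf_le_const) (rule orthonormal0_bessel_finite)
qed

end

section \<open>Convergent expansions, orthogonal projection and the Riesz theorem\<close>

lemma orthonormal0_sums:
  fixes g :: "nat \<Rightarrow> 'a::{real_inner, complete_space}"
  assumes g: "orthonormal0 g" and c: "summable (\<lambda>i. (c i)\<^sup>2)"
  obtains s where "(\<lambda>i. c i *\<^sub>R g i) sums s"
proof -
  have "Cauchy (\<lambda>n. \<Sum>i<n. c i *\<^sub>R g i)"
  proof (rule CauchyI')
    fix \<epsilon> :: real assume \<epsilon>: "\<epsilon> > 0"
    then obtain N where N: "\<And>m n. m \<ge> N \<Longrightarrow> norm (\<Sum>i\<in>{m..<n}. (c i)\<^sup>2) < \<epsilon>\<^sup>2"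
      using c[unfolded summable_Cauchy] by (metis zero_less_power)
    have "norm ((\<Sum>i<m. c i *\<^sub>R g i) - (\<Sum>i<n. c i *\<^sub>R g i)) < \<epsilon>" if "N \<le> m" "m < n" for m n
    proof -
      have "(\<Sum>i<n. c i *\<^sub>R g i) - (\<Sum>i<m. c i *\<^sub>R g i) = (\<Sum>i\<in>{m..<n}. c i *\<^sub>R g i)"
        using that by (metis less_imp_le_nat sum_diff_nat_ivl zero_le lessThan_atLeast0)
      moreover have "(norm (\<Sum>i\<in>{m..<n}. c i *\<^sub>R g i))\<^sup>2 < \<epsilon>\<^sup>2"
        using orthonormal0_norm_sum[OF g, of "{m..<n}" c] N[OF that(1), of n] by simp
      ultimately show ?thesis
        using \<epsilon> by (metis norm_minus_commute power_less_imp_less_base less_imp_le)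
    qed
    then show "\<exists>M. \<forall>m\<ge>M. \<forall>n>m. dist (\<Sum>i<m. c i *\<^sub>R g i) (\<Sum>i<n. c i *\<^sub>R g i) < \<epsilon>"
      unfolding dist_norm by blast
  qed
  then show thesis
    using that unfolding sums_def Cauchy_convergent_iff convergent_def by auto
qed

lemma orthonormal0_projection:
  fixes g :: "nat \<Rightarrow> 'a::{real_inner, complete_space}"
  assumes g: "orthonormal0 g"
  obtains p where "(\<lambda>i. (x \<bullet> g i) *\<^sub>R g i) sums p"
    "\<And>r. r \<in> closure (span (range g)) \<Longrightarrow> (x - p) \<bullet> r = 0"
proof -
  obtain p where p: "(\<lambda>i. (x \<bullet> g i) *\<^sub>R g i) sums p"
    using orthonormal0_sums[OF g orthonormal0_bessel_summable[OF g]] .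
  have "(\<lambda>n. (\<Sum>i<n. (x \<bullet> g i) *\<^sub>R g i) \<bullet> g j) \<longlonglongrightarrow> p \<bullet> g j" for j
    using p unfolding sums_def by (intro tendsto_inner tendsto_const)
  \<comment> \<open>The inner product of the partial sums with \<open>g j\<close> is constant once
    the index \<open>j\<close> is included, that is from \<open>n = Suc j\<close> on.\<close>
  moreover have "(\<lambda>n. (\<Sum>i<n. (x \<bullet> g i) *\<^sub>R g i) \<bullet> g j) \<longlonglongrightarrow> x \<bullet> g j" for j
    by (rule tendsto_eventually, rule eventually_sequentiallyI[of "Suc j"])
      (simp add: orthonormal0_inner_sum[OF g] orthonormal0_inner_scale[OF g])
  ultimately have eq: "p \<bullet> g j = x \<bullet> g j" for j
    using LIMSEQ_unique by blast
  let ?N = "{r. (x - p) \<bullet> r = 0}"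
  have "closed ?N"
    by (intro closed_Collect_eq continuous_intros)
  moreover have "span (range g) \<subseteq> ?N"
    by (rule span_minimal) (auto simp: subspace_def inner_diff_left inner_add_right eq)
  ultimately have "closure (span (range g)) \<subseteq> ?N"
    by (rule closure_minimal[rotated])
  with p that show thesis by blast
qed

text \<open>The expansion of \<open>x\<close> in a basis lying in \<open>R\<close> has its partial
  sums, hence by closedness its sum, in \<open>R\<close>.\<close>

lemma ex_orthogonal_projection:
  fixes R :: "'a::{real_inner, polish_space} set"
  assumes R: "subspace R" "closed R"
  obtains p where "p \<in> R" "\<And>r. r \<in> R \<Longrightarrow> (x - p) \<bullet> r = 0"
proof -
  have "R \<noteq> {}"
    using R(1) subspace_0 by blast
  then obtain g where g: "orthonormal0 g" "range g \<subseteq> span R" "R \<subseteq> closure (span (range g))"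
    by (rule ex_orthonormal0)
  obtain p where p: "(\<lambda>i. (x \<bullet> g i) *\<^sub>R g i) sums p"
    "\<And>r. r \<in> closure (span (range g)) \<Longrightarrow> (x - p) \<bullet> r = 0"
    using orthonormal0_projection[OF g(1), of x] by blast
  have gR: "g i \<in> R" for i
    using g(2) R(1) span_eq_iff by blast
  have "(\<Sum>i<n. (x \<bullet> g i) *\<^sub>R g i) \<in> R" for n
    using R(1) gR by (intro subspace_sum subspace_scale)
  then have "p \<in> R"
    using p(1) R(2) unfolding sums_def by (metis closed_sequentially)
  with p(2) g(3) that show thesis by blast
qed

text \<open>For a total family, the difference of \<open>x\<close> and its projection is orthogonal
  to everything, itself included.\<close>

lemma ex_orthonormal0_basis:
  obtains g :: "nat \<Rightarrow> 'a::{real_inner, polish_space}"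
  where "orthonormal0 g" "\<And>x. (\<lambda>i. (x \<bullet> g i) *\<^sub>R g i) sums x"
proof -
  obtain g :: "nat \<Rightarrow> 'a" where g: "orthonormal0 g" "UNIV \<subseteq> closure (span (range g))"
    by (rule ex_orthonormal0[of UNIV]) auto
  have "(\<lambda>i. (x \<bullet> g i) *\<^sub>R g i) sums x" for x
  proof -
    obtain p where p: "(\<lambda>i. (x \<bullet> g i) *\<^sub>R g i) sums p"
      "\<And>r. r \<in> closure (span (range g)) \<Longrightarrow> (x - p) \<bullet> r = 0"
      using orthonormal0_projection[OF g(1), of x] by blast
    have "x - p \<in> closure (span (range g))"
      using g(2) by (rule subsetD) (rule UNIV_I)
    from p(2)[OF this] have "x = p" by simp
    with p(1) show ?thesis by simp
  qed
  with g(1) that show thesis by blast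
qed

text \<open>The representing vector must have the coefficients \<open>\<phi> (g i)\<close>.
  Evaluating \<phi> at the partial sum with these very coefficients bounds the sum of squares
  \<open>?S\<close> by \<open>C\<close> times its own square root, so \<open>?S \<le> C^2\<close>
  and the series converges.\<close>

theorem riesz_representation:
  fixes \<phi> :: "'a::{real_inner, polish_space} \<Rightarrow> real"
  assumes "bounded_linear \<phi>"
  shows "\<exists>v. \<forall>y. \<phi> y = v \<bullet> y"
proof -
  interpret bounded_linear \<phi> by fact
  obtain C where C: "C > 0" "\<And>y. \<bar>\<phi> y\<bar> \<le> norm y * C"
    using pos_bounded by auto
  obtain g :: "nat \<Rightarrow> 'a" where g: "orthonormal0 g" "\<And>x. (\<lambda>i. (x \<bullet> g i) *\<^sub>R g i) sums x"
    using ex_orthonormal0_basis by blast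
  have bound: "(\<Sum>i<n. (\<phi> (g i))\<^sup>2) \<le> C\<^sup>2" for n
  proof -
    let ?S = "\<Sum>i<n. (\<phi> (g i))\<^sup>2"
    have S: "0 \<le> ?S" by (intro sum_nonneg) simp
    have "?S = \<phi> (\<Sum>i<n. \<phi> (g i) *\<^sub>R g i)"
      by (simp add: sum scaleR power2_eq_square)
    also have "\<dots> \<le> norm (\<Sum>i<n. \<phi> (g i) *\<^sub>R g i) * C"
      using C(2) abs_le_D1 by blast
    finally have "?S\<^sup>2 \<le> (norm (\<Sum>i<n. \<phi> (g i) *\<^sub>R g i))\<^sup>2 * C\<^sup>2"
      using S by (metis power_mono power_mult_distrib)
    also have "\<dots> \<le> ?S * C\<^sup>2"
      by (intro mult_right_mono orthonormal0_norm_sum[OF g(1)]) auto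
    finally show ?thesis
      using S by (cases "?S = 0") (auto simp: power2_eq_square)
  qed
  have "summable (\<lambda>i. (\<phi> (g i))\<^sup>2)"
  proof (rule bounded_imp_summable)
    show "(\<Sum>i\<le>n. (\<phi> (g i))\<^sup>2) \<le> C\<^sup>2" for n
      using bound[of "Suc n"] unfolding lessThan_Suc_atMost .
  qed simp
  then obtain v where v: "(\<lambda>i. \<phi> (g i) *\<^sub>R g i) sums v"
    by (rule orthonormal0_sums[OF g(1)])
  have "\<phi> y = v \<bullet> y" for y
  proof (rule LIMSEQ_unique)
    show "(\<lambda>n. \<phi> (\<Sum>i<n. (y \<bullet> g i) *\<^sub>R g i)) \<longlonglongrightarrow> \<phi> y"
      using g(2)[of y] unfolding sums_def by (rule tendsto)
    have *: "\<phi> (\<Sum>i<n. (y \<bullet> g i) *\<^sub>R g i) = (\<Sum>i<n. \<phi> (g i) *\<^sub>R g i) \<bullet> y" for n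
      unfolding sum scaleR inner_sum_left inner_scaleR_left
      by (intro sum.cong) (simp_all add: inner_commute mult.commute)
    show "(\<lambda>n. \<phi> (\<Sum>i<n. (y \<bullet> g i) *\<^sub>R g i)) \<longlonglongrightarrow> v \<bullet> y"
      unfolding * by (intro tendsto_inner tendsto_const v[unfolded sums_def])
  qed
  then show ?thesis by blast
qed


section \<open>Weak integrals of Hilbert space valued functions\<close>

text \<open>
  The Bochner integral of the library lives on the class \<^class>\<open>banach\<close>, of which a type of sort
  \<open>{real_inner, polish_space}\<close> is not known to be an instance.
\<close>

definition weak_integral :: "'a measure \<Rightarrow> ('a \<Rightarrow> 'j::real_inner) \<Rightarrow> 'j" where
  "weak_integral M f = (THE v. \<forall>y. v \<bullet> y = (\<integral>\<omega>. f \<omega> \<bullet> y \<partial>M))"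

definition norm_integrable :: "'a measure \<Rightarrow> ('a \<Rightarrow> 'j::real_normed_vector) \<Rightarrow> bool" where
  "norm_integrable M f \<longleftrightarrow> f \<in> borel_measurable M \<and> integrable M (\<lambda>\<omega>. norm (f \<omega>))"

lemma norm_integrable_bound:
  fixes f :: "'a \<Rightarrow> 'j::real_normed_vector"
  assumes "f \<in> borel_measurable M" "integrable M B" "\<And>\<omega>. norm (f \<omega>) \<le> B \<omega>"
  shows "norm_integrable M f"
  unfolding norm_integrable_def
proof
  have [measurable]: "f \<in> borel_measurable M" by fact
  have "norm (norm (f \<omega>)) \<le> norm (B \<omega>)" for \<omega>
    using assms(3)[of \<omega>] by simp
  then show "integrable M (\<lambda>\<omega>. norm (f \<omega>))"
    by (intro Bochner_Integration.integrable_bound[OF assms(2)]) auto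
qed fact

lemma norm_integrable_inner:
  fixes f :: "'a \<Rightarrow> 'j::{real_inner, second_countable_topology}"
  assumes "norm_integrable M f"
  shows "integrable M (\<lambda>\<omega>. f \<omega> \<bullet> y)"
proof (rule Bochner_Integration.integrable_bound)
  show "integrable M (\<lambda>\<omega>. norm (f \<omega>) * norm y)"
    using assms by (simp add: norm_integrable_def)
  show "(\<lambda>\<omega>. f \<omega> \<bullet> y) \<in> borel_measurable M"
    using assms by (auto simp: norm_integrable_def)
qed (simp add: Cauchy_Schwarz_ineq2)

lemma norm_integrable_add:
  fixes f g :: "'a \<Rightarrow> 'j::{real_normed_vector, second_countable_topology}"
  assumes "norm_integrable M f" "norm_integrable M g"
  shows "norm_integrable M (\<lambda>\<omega>. f \<omega> + g \<omega>)"
  using assms by (intro norm_integrable_bound[where B = "\<lambda>\<omega>. norm (f \<omega>) + norm (g \<omega>)"])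
    (auto simp: norm_integrable_def norm_triangle_ineq)

lemma norm_integrable_scaleR:
  fixes f :: "'a \<Rightarrow> 'j::{real_normed_vector, second_countable_topology}"
  assumes "norm_integrable M f"
  shows "norm_integrable M (\<lambda>\<omega>. c *\<^sub>R f \<omega>)"
  using assms by (auto simp: norm_integrable_def)

lemma norm_integrable_diff:
  fixes f g :: "'a \<Rightarrow> 'j::{real_normed_vector, second_countable_topology}"
  assumes "norm_integrable M f" "norm_integrable M g"
  shows "norm_integrable M (\<lambda>\<omega>. f \<omega> - g \<omega>)"
  using norm_integrable_add[OF assms(1) norm_integrable_scaleR[OF assms(2), of "-1"]] by simp

text \<open>Integrability of the norm makes the integrated inner product a bounded functional of
  \<open>y\<close>; Riesz supplies the vector that the definite description denotes.\<close>

lemma weak_integral_inner: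
  fixes f :: "'a \<Rightarrow> 'j::{real_inner, polish_space}"
  assumes "norm_integrable M f"
  shows "weak_integral M f \<bullet> y = (\<integral>\<omega>. f \<omega> \<bullet> y \<partial>M)"
proof -
  note int = norm_integrable_inner[OF assms]
  have "bounded_linear (\<lambda>y. \<integral>\<omega>. f \<omega> \<bullet> y \<partial>M)"
  proof
    fix y z
    show "(\<integral>\<omega>. f \<omega> \<bullet> (y + z) \<partial>M) = (\<integral>\<omega>. f \<omega> \<bullet> y \<partial>M) + (\<integral>\<omega>. f \<omega> \<bullet> z \<partial>M)"
      by (simp add: inner_add_right int)
  next
    fix c y
    show "(\<integral>\<omega>. f \<omega> \<bullet> (c *\<^sub>R y) \<partial>M) = c *\<^sub>R (\<integral>\<omega>. f \<omega> \<bullet> y \<partial>M)"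
      by simp
  next
    have "norm (\<integral>\<omega>. f \<omega> \<bullet> y \<partial>M) \<le> norm y * (\<integral>\<omega>. norm (f \<omega>) \<partial>M)" for y
    proof -
      have "norm (\<integral>\<omega>. f \<omega> \<bullet> y \<partial>M) \<le> (\<integral>\<omega>. norm y * norm (f \<omega>) \<partial>M)"
        by (intro order_trans[OF integral_norm_bound] integral_mono integrable_norm int)
          (use assms in \<open>auto simp: norm_integrable_def mult.commute[of "norm y"] Cauchy_Schwarz_ineq2\<close>)
      then show ?thesis by simp
    qed
    then show "\<exists>K. \<forall>y. norm (\<integral>\<omega>. f \<omega> \<bullet> y \<partial>M) \<le> norm y * K" by blast
  qed
  from riesz_representation[OF this] obtain v where v: "\<And>y. (\<integral>\<omega>. f \<omega> \<bullet> y \<partial>M) = v \<bullet> y"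
    by auto
  have "weak_integral M f = v"
    unfolding weak_integral_def v
    by (rule the_equality) (simp_all add: vector_eq_rdot)
  then show ?thesis by (simp add: v)
qed

lemma weak_integral_eqI:
  fixes f :: "'a \<Rightarrow> 'j::{real_inner, polish_space}"
  assumes "norm_integrable M f" "\<And>y. (\<integral>\<omega>. f \<omega> \<bullet> y \<partial>M) = v \<bullet> y"
  shows "weak_integral M f = v"
  using weak_integral_inner[OF assms(1)] assms(2) by (metis vector_eq_rdot)

lemma weak_integral_add:
  fixes f g :: "'a \<Rightarrow> 'j::{real_inner, polish_space}"
  assumes "norm_integrable M f" "norm_integrable M g"
  shows "weak_integral M (\<lambda>\<omega>. f \<omega> + g \<omega>) = weak_integral M f + weak_integral M g"
  by (rule weak_integral_eqI[OF norm_integrable_add[OF assms]])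
    (simp add: inner_add_left weak_integral_inner norm_integrable_inner assms)

lemma weak_integral_diff:
  fixes f g :: "'a \<Rightarrow> 'j::{real_inner, polish_space}"
  assumes "norm_integrable M f" "norm_integrable M g"
  shows "weak_integral M (\<lambda>\<omega>. f \<omega> - g \<omega>) = weak_integral M f - weak_integral M g"
  by (rule weak_integral_eqI[OF norm_integrable_diff[OF assms]])
    (simp add: inner_diff_left weak_integral_inner norm_integrable_inner assms)

lemma weak_integral_scaleR:
  fixes f :: "'a \<Rightarrow> 'j::{real_inner, polish_space}"
  assumes "norm_integrable M f"
  shows "weak_integral M (\<lambda>\<omega>. c *\<^sub>R f \<omega>) = c *\<^sub>R weak_integral M f"
  by (rule weak_integral_eqI[OF norm_integrable_scaleR[OF assms]])
    (simp add: weak_integral_inner assms)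

text \<open>Pairing the integral with itself and dividing by its norm.\<close>

lemma norm_weak_integral_le:
  fixes f :: "'a \<Rightarrow> 'j::{real_inner, polish_space}"
  assumes f: "norm_integrable M f" and B: "integrable M B" "\<And>\<omega>. norm (f \<omega>) \<le> B \<omega>"
  shows "norm (weak_integral M f) \<le> (\<integral>\<omega>. B \<omega> \<partial>M)"
proof -
  let ?v = "weak_integral M f"
  have "?v \<bullet> ?v = (\<integral>\<omega>. f \<omega> \<bullet> ?v \<partial>M)"
    by (rule weak_integral_inner[OF f])
  also have "\<dots> \<le> (\<integral>\<omega>. norm ?v * B \<omega> \<partial>M)"
  proof (rule integral_mono)
    show "f \<omega> \<bullet> ?v \<le> norm ?v * B \<omega>" for \<omega>
      using norm_cauchy_schwarz[of "f \<omega>" ?v] mult_left_mono[OF B(2)[of \<omega>] norm_ge_zero[of ?v]]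
      by (simp add: mult.commute)
  qed (use norm_integrable_inner[OF f] B(1) in auto)
  finally have "norm ?v * norm ?v \<le> norm ?v * (\<integral>\<omega>. B \<omega> \<partial>M)"
    by (simp flip: power2_norm_eq_inner add: power2_eq_square)
  moreover have "0 \<le> (\<integral>\<omega>. B \<omega> \<partial>M)"
    by (rule Bochner_Integration.integral_nonneg) (rule order_trans[OF norm_ge_zero B(2)])
  ultimately show ?thesis
    by (cases "norm ?v = 0") auto
qed

lemma integral_mult_le_sqrt:
  fixes A B :: "'a \<Rightarrow> real"
  assumes [measurable]: "A \<in> borel_measurable M" "B \<in> borel_measurable M"
    and int: "integrable M (\<lambda>\<omega>. (A \<omega>)\<^sup>2)" "integrable M (\<lambda>\<omega>. (B \<omega>)\<^sup>2)"
  shows "integrable M (\<lambda>\<omega>. \<bar>A \<omega>\<bar> * \<bar>B \<omega>\<bar>)"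
    and "(\<integral>\<omega>. \<bar>A \<omega>\<bar> * \<bar>B \<omega>\<bar> \<partial>M) \<le> sqrt (\<integral>\<omega>. (A \<omega>)\<^sup>2 \<partial>M) * sqrt (\<integral>\<omega>. (B \<omega>)\<^sup>2 \<partial>M)"
proof -
  show *: "integrable M (\<lambda>\<omega>. \<bar>A \<omega>\<bar> * \<bar>B \<omega>\<bar>)"
  proof (rule Bochner_Integration.integrable_bound)
    show "integrable M (\<lambda>\<omega>. (A \<omega>)\<^sup>2 + (B \<omega>)\<^sup>2)" using int by simp
    have "\<bar>a\<bar> * \<bar>b\<bar> \<le> a\<^sup>2 + b\<^sup>2" for a b :: real
      using sum_squares_bound[of "\<bar>a\<bar>" "\<bar>b\<bar>"] mult_nonneg_nonneg[of "\<bar>a\<bar>" "\<bar>b\<bar>"]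
      unfolding power2_abs by linarith
    then show "AE \<omega> in M. norm (\<bar>A \<omega>\<bar> * \<bar>B \<omega>\<bar>) \<le> norm ((A \<omega>)\<^sup>2 + (B \<omega>)\<^sup>2)"
      by (auto simp: abs_mult)
  qed simp
  let ?I = "\<integral>\<omega>. \<bar>A \<omega>\<bar> * \<bar>B \<omega>\<bar> \<partial>M" and ?a = "\<integral>\<omega>. (A \<omega>)\<^sup>2 \<partial>M" and ?b = "\<integral>\<omega>. (B \<omega>)\<^sup>2 \<partial>M"
  have nn: "0 \<le> ?I" "0 \<le> ?a" "0 \<le> ?b" by simp_all
  have "ennreal (?I\<^sup>2) \<le> ennreal (?a * ?b)"
    using Cauchy_Schwarz_nn_integral[of "\<lambda>\<omega>. ennreal \<bar>A \<omega>\<bar>" M "\<lambda>\<omega>. ennreal \<bar>B \<omega>\<bar>"] nn * int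
    by (simp add: ennreal_mult[symmetric] ennreal_power nn_integral_eq_integral)
  then have "?I\<^sup>2 \<le> ?a * ?b"
    using nn by simp
  then show "?I \<le> sqrt ?a * sqrt ?b"
    unfolding real_sqrt_mult[symmetric] by (rule real_le_rsqrt)
qed


section \<open>Smoothing by finite Gaussian sums\<close>

lemma gsum_shift: "gsum n v (shift n h \<omega>) = gsum n v \<omega> + (\<Sum>i<n. h i *\<^sub>R v i)"
  by (simp add: gsum_def shift_def scaleR_add_left sum.distrib)

lemma
  fixes v :: "nat \<Rightarrow> 'h::real_inner"
  shows integrable_norm_gsum: "integrable gauss_seq (\<lambda>\<omega>. (norm (gsum n v \<omega>))\<^sup>2)"
    and integral_norm_gsum: "(\<integral>\<omega>. (norm (gsum n v \<omega>))\<^sup>2 \<partial>gauss_seq) = (\<Sum>i<n. (norm (v i))\<^sup>2)"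
  using integrable_gsum_inner[of n v v] integral_gsum_inner[of n v v]
  by (simp_all add: power2_norm_eq_inner)

lemma
  fixes h :: "nat \<Rightarrow> real"
  shows integrable_gsum_power2: "integrable gauss_seq (\<lambda>\<omega>. (gsum n h \<omega>)\<^sup>2)"
    and integral_gsum_power2: "(\<integral>\<omega>. (gsum n h \<omega>)\<^sup>2 \<partial>gauss_seq) = (\<Sum>i<n. (h i)\<^sup>2)"
  using integrable_norm_gsum[of n h] integral_norm_gsum[of n h] by simp_all

lemma
  fixes h :: "nat \<Rightarrow> real"
  shows integrable_gsum: "integrable gauss_seq (gsum n h)"
    and integral_gsum: "(\<integral>\<omega>. gsum n h \<omega> \<partial>gauss_seq) = 0"
  unfolding gsum_def by (simp_all add: integrable_coord integral_coord)

lemma gauss_seq_abs_le_sqrt: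
  fixes A :: "(nat \<Rightarrow> real) \<Rightarrow> real"
  assumes [measurable]: "A \<in> borel_measurable gauss_seq" and int: "integrable gauss_seq (\<lambda>\<omega>. (A \<omega>)\<^sup>2)"
  shows "integrable gauss_seq (\<lambda>\<omega>. \<bar>A \<omega>\<bar>)"
    and "(\<integral>\<omega>. \<bar>A \<omega>\<bar> \<partial>gauss_seq) \<le> sqrt (\<integral>\<omega>. (A \<omega>)\<^sup>2 \<partial>gauss_seq)"
  using integral_mult_le_sqrt[of A gauss_seq "\<lambda>_. 1"] int gauss_seq.prob_space by simp_all

text \<open>The shift formula for the constant function 1.\<close>

lemma
  shows integrable_cm_density: "integrable gauss_seq (cm_density n h)"
    and integral_cm_density: "(\<integral>\<omega>. cm_density n h \<omega> \<partial>gauss_seq) = 1"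
  using integrable_shift_iff[of "\<lambda>_. 1" n h] integral_shift[of "\<lambda>_. 1" n h] gauss_seq.prob_space
  by simp_all

text \<open>The shift formula read backwards: shifting adds the sum of the
  \<open>(h i)\<^sup>2\<close> to \<open>gsum n h\<close>, which is itself centred.\<close>

lemma
  shows integrable_cm_density_gsum: "integrable gauss_seq (\<lambda>\<omega>. cm_density n h \<omega> * gsum n h \<omega>)"
    and integral_cm_density_gsum:
      "(\<integral>\<omega>. cm_density n h \<omega> * gsum n h \<omega> \<partial>gauss_seq) = (\<Sum>i<n. (h i)\<^sup>2)"
proof -
  have eq: "gsum n h (shift n h \<omega>) = gsum n h \<omega> + (\<Sum>i<n. (h i)\<^sup>2)" for \<omega>
    by (simp add: gsum_shift power2_eq_square)
  show "integrable gauss_seq (\<lambda>\<omega>. cm_density n h \<omega> * gsum n h \<omega>)"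
    by (subst integrable_shift_iff) (simp_all add: eq integrable_gsum)
  show "(\<integral>\<omega>. cm_density n h \<omega> * gsum n h \<omega> \<partial>gauss_seq) = (\<Sum>i<n. (h i)\<^sup>2)"
    by (subst integral_shift[symmetric])
      (simp_all add: eq integrable_gsum integral_gsum gauss_seq.prob_space)
qed

text \<open>Squaring doubles the exponent: up to the factor
  \<open>exp (\<Sum>i<n. (h i)\<^sup>2)\<close> the square is the density for the shift
  \<open>2 * h i\<close>, whose integral is 1.\<close>

lemma
  shows integrable_cm_density_power2: "integrable gauss_seq (\<lambda>\<omega>. (cm_density n h \<omega>)\<^sup>2)"
    and integral_cm_density_power2:
      "(\<integral>\<omega>. (cm_density n h \<omega>)\<^sup>2 \<partial>gauss_seq) = exp (\<Sum>i<n. (h i)\<^sup>2)"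
proof -
  have eq: "(cm_density n h \<omega>)\<^sup>2 = exp (\<Sum>i<n. (h i)\<^sup>2) * cm_density n (\<lambda>i. 2 * h i) \<omega>" for \<omega>
  proof -
    have "(\<Sum>i<n. \<omega> i * (2 * h i)) = 2 * (\<Sum>i<n. \<omega> i * h i)"
      by (simp add: sum_distrib_left mult.left_commute)
    moreover have "(\<Sum>i<n. (2 * h i)\<^sup>2) = 4 * (\<Sum>i<n. (h i)\<^sup>2)"
      by (simp add: sum_distrib_left power_mult_distrib)
    ultimately show ?thesis
      unfolding cm_density_def by (simp add: power2_eq_square flip: exp_add)
  qed
  show "integrable gauss_seq (\<lambda>\<omega>. (cm_density n h \<omega>)\<^sup>2)"
    unfolding eq by (simp add: integrable_cm_density)
  show "(\<integral>\<omega>. (cm_density n h \<omega>)\<^sup>2 \<partial>gauss_seq) = exp (\<Sum>i<n. (h i)\<^sup>2)"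
    unfolding eq by (simp add: integral_cm_density)
qed

text \<open>
  Writing \<open>Z\<close> for the density, \<open>X\<close> for the Gaussian sum and \<open>c\<close> for its variance, one has
  \<open>E (Z - 1 - X)\<^sup>2 = exp c - 1 - c\<close>. The bound does not depend on \<open>n\<close>, which lets the derivatives
  of the smoothed functions pass to the limit \<open>n \<rightarrow> \<infinity>\<close>.
\<close>

lemma cm_density_remainder:
  fixes h :: "nat \<Rightarrow> real"
  assumes c: "(\<Sum>i<n. (h i)\<^sup>2) \<le> 1"
  shows "integrable gauss_seq (\<lambda>\<omega>. \<bar>cm_density n h \<omega> - 1 - gsum n h \<omega>\<bar>)" (is ?A)
    and "(\<integral>\<omega>. \<bar>cm_density n h \<omega> - 1 - gsum n h \<omega>\<bar> \<partial>gauss_seq) \<le> (\<Sum>i<n. (h i)\<^sup>2)" (is "?I \<le> _")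
proof -
  let ?c = "\<Sum>i<n. (h i)\<^sup>2"
  let ?R = "\<lambda>\<omega>. cm_density n h \<omega> - 1 - gsum n h \<omega>"
  have c0: "0 \<le> ?c" by (intro sum_nonneg) simp
  have eq: "(?R \<omega>)\<^sup>2 = (cm_density n h \<omega>)\<^sup>2 + 1 + (gsum n h \<omega>)\<^sup>2 - 2 * cm_density n h \<omega>
      - 2 * (cm_density n h \<omega> * gsum n h \<omega>) + 2 * gsum n h \<omega>" for \<omega>
    by (simp add: power2_eq_square algebra_simps)
  note ints = integrable_cm_density_power2 integrable_gsum_power2 integrable_cm_density
    integrable_cm_density_gsum integrable_gsum
  have int: "integrable gauss_seq (\<lambda>\<omega>. (?R \<omega>)\<^sup>2)"
    unfolding eq using ints by (intro Bochner_Integration.integrable_add Bochner_Integration.integrable_diff) auto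
  have "(\<integral>\<omega>. (?R \<omega>)\<^sup>2 \<partial>gauss_seq) = exp ?c - 1 - ?c"
    unfolding eq using ints
    by (simp add: integral_cm_density_power2 integral_gsum_power2 integral_cm_density
        integral_cm_density_gsum integral_gsum gauss_seq.prob_space)
  \<comment> \<open>The bound \<open>exp c \<le> 1 + c + c^2\<close> on the unit interval is the
    reason for the hypothesis \<open>c\<close>.\<close>
  also have "\<dots> \<le> ?c\<^sup>2"
    using exp_bound[OF c0 c] by simp
  finally have "sqrt (\<integral>\<omega>. (?R \<omega>)\<^sup>2 \<partial>gauss_seq) \<le> ?c"
    using c0 by (simp add: real_le_lsqrt)
  with gauss_seq_abs_le_sqrt[of ?R] int show ?A "?I \<le> ?c" by auto
qed

section \<open>The smoothed function and its derivative for finitely many directions\<close>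

definition smooth_n :: "nat \<Rightarrow> (nat \<Rightarrow> 'h) \<Rightarrow> ('h::real_normed_vector \<Rightarrow> 'j::real_inner) \<Rightarrow> 'h \<Rightarrow> 'j" where
  "smooth_n n e f x = weak_integral gauss_seq (\<lambda>\<omega>. f (x + gsum n e \<omega>))"

definition smooth_deriv_n ::
  "nat \<Rightarrow> (nat \<Rightarrow> 'h) \<Rightarrow> ('h::real_normed_vector \<Rightarrow> 'j::real_inner) \<Rightarrow> 'h \<Rightarrow> (nat \<Rightarrow> real) \<Rightarrow> 'j" where
  "smooth_deriv_n n e f x h = weak_integral gauss_seq (\<lambda>\<omega>. gsum n h \<omega> *\<^sub>R f (x + gsum n e \<omega>))"

text \<open>Reduces Hoelder increments to second moments: the first bound serves the approximation
  error, the second, under Cauchy-Schwarz, the derivative.\<close>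

lemma powr_le_1_plus_square:
  fixes u :: real
  assumes "0 \<le> u" "0 < \<alpha>" "\<alpha> < 1"
  shows "u powr \<alpha> \<le> 1 + u\<^sup>2" "(u powr \<alpha>)\<^sup>2 \<le> 1 + u\<^sup>2"
proof -
  have "u powr \<alpha> \<le> 1 + u\<^sup>2 \<and> (u powr \<alpha>)\<^sup>2 \<le> 1 + u\<^sup>2"
  proof (cases "u \<le> 1")
    case True
    then have "u powr \<alpha> \<le> 1"
      using assms powr_mono2[of \<alpha> u 1] by simp
    then show ?thesis
      using power_le_one[of "u powr \<alpha>" 2] by (smt (verit) powr_ge_zero zero_le_power2)
  next
    case False
    then have "u powr \<alpha> \<le> u"
      using assms powr_mono[of \<alpha> 1 u] by simp
    moreover have "u \<le> u\<^sup>2"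
      using False by (simp add: power2_eq_square)
    moreover have "(u powr \<alpha>)\<^sup>2 \<le> u\<^sup>2"
      using \<open>u powr \<alpha> \<le> u\<close> by (intro power_mono) auto
    ultimately show ?thesis by linarith
  qed
  then show "u powr \<alpha> \<le> 1 + u\<^sup>2" "(u powr \<alpha>)\<^sup>2 \<le> 1 + u\<^sup>2" by auto
qed

context
  fixes f :: "'h::{real_inner, second_countable_topology} \<Rightarrow> 'j::{real_inner, polish_space}"
    and B :: real
  assumes f_cont: "continuous_on UNIV f" and f_le: "\<And>x. norm (f x) \<le> B"
begin

lemma f_measurable [measurable]: "f \<in> borel_measurable borel"
  by (rule borel_measurable_continuous_onI[OF f_cont])

lemma B_nonneg: "0 \<le> B"
  using order_trans[OF norm_ge_zero f_le] .

lemma norm_integrable_f: "norm_integrable gauss_seq (\<lambda>\<omega>. f (x + gsum n e \<omega>))"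
  by (rule norm_integrable_bound[where B = "\<lambda>_. B"]) (simp_all add: f_le)

lemma norm_integrable_gsum_f: "norm_integrable gauss_seq (\<lambda>\<omega>. gsum m h \<omega> *\<^sub>R f (x + gsum n e \<omega>))"
proof (rule norm_integrable_bound[where B = "\<lambda>\<omega>. \<bar>gsum m h \<omega>\<bar> * B"])
  show "norm (gsum m h \<omega> *\<^sub>R f (x + gsum n e \<omega>)) \<le> \<bar>gsum m h \<omega>\<bar> * B" for \<omega>
    by (simp add: mult_left_mono f_le)
qed (use integrable_gsum[of m h] in auto)

lemma norm_smooth_n_le: "norm (smooth_n n e f x) \<le> B"
  using norm_weak_integral_le[OF norm_integrable_f, where B = "\<lambda>_. B"] gauss_seq.prob_space
  by (simp add: smooth_n_def f_le)

lemma smooth_n_diff_le: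
  assumes "\<And>z. norm (f (x + z) - f (y + z)) \<le> d"
  shows "norm (smooth_n n e f x - smooth_n n e f y) \<le> d"
  using norm_weak_integral_le[OF norm_integrable_diff[OF norm_integrable_f norm_integrable_f],
      where B = "\<lambda>_. d"] assms gauss_seq.prob_space
  by (simp add: smooth_n_def flip: weak_integral_diff[OF norm_integrable_f norm_integrable_f])

text \<open>Both integrals carry the same factor \<open>gsum n h\<close>, whose mean absolute value
  is at most the square root of its variance. This yields uniform continuity of the
  gradient.\<close>

lemma smooth_deriv_n_diff_le:
  assumes "\<And>z. norm (f (x + z) - f (y + z)) \<le> d"
  shows "norm (smooth_deriv_n n e f x h - smooth_deriv_n n e f y h) \<le> d * sqrt (\<Sum>i<n. (h i)\<^sup>2)"
proof -
  have d: "0 \<le> d"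
    using order_trans[OF norm_ge_zero assms] .
  have "norm (smooth_deriv_n n e f x h - smooth_deriv_n n e f y h)
      \<le> (\<integral>\<omega>. d * \<bar>gsum n h \<omega>\<bar> \<partial>gauss_seq)"
    unfolding smooth_deriv_n_def weak_integral_diff[OF norm_integrable_gsum_f norm_integrable_gsum_f, symmetric]
  proof (rule norm_weak_integral_le)
    show "norm (gsum n h \<omega> *\<^sub>R f (x + gsum n e \<omega>) - gsum n h \<omega> *\<^sub>R f (y + gsum n e \<omega>)) \<le> d * \<bar>gsum n h \<omega>\<bar>" for \<omega>
      using mult_right_mono[OF assms[of "gsum n e \<omega>"], of "\<bar>gsum n h \<omega>\<bar>"]
      by (simp add: mult.commute flip: scaleR_diff_right)
  qed (use integrable_gsum[of n h] norm_integrable_diff[OF norm_integrable_gsum_f norm_integrable_gsum_f] in auto)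
  also have "\<dots> \<le> d * sqrt (\<Sum>i<n. (h i)\<^sup>2)"
    using gauss_seq_abs_le_sqrt(2)[of "gsum n h"] d
    by (simp add: integrable_gsum_power2 integral_gsum_power2 mult_left_mono)
  finally show ?thesis .
qed

text \<open>Cameron-Martin moves the displacement from the argument of \<open>f\<close> into the
  density, which splits as \<open>1 + gsum n h + ?R\<close>: the function value, the derivative, and
  an error of mean size quadratic in \<open>h\<close>. The bound is uniform in \<open>n\<close>,
  \<open>x\<close> and \<open>e\<close>.\<close>

lemma smooth_n_remainder:
  assumes c: "(\<Sum>i<n. (h i)\<^sup>2) \<le> 1"
  shows "norm (smooth_n n e f (x + (\<Sum>i<n. h i *\<^sub>R e i)) - smooth_n n e f x - smooth_deriv_n n e f x h)
    \<le> B * (\<Sum>i<n. (h i)\<^sup>2)"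
proof -
  let ?F = "\<lambda>\<omega>. f (x + gsum n e \<omega>)"
  let ?R = "\<lambda>\<omega>. cm_density n h \<omega> - 1 - gsum n h \<omega>"
  have intR: "norm_integrable gauss_seq (\<lambda>\<omega>. ?R \<omega> *\<^sub>R ?F \<omega>)"
  proof (rule norm_integrable_bound[where B = "\<lambda>\<omega>. \<bar>?R \<omega>\<bar> * B"])
    show "norm (?R \<omega> *\<^sub>R ?F \<omega>) \<le> \<bar>?R \<omega>\<bar> * B" for \<omega>
      by (simp add: mult_left_mono f_le)
  qed (use cm_density_remainder(1)[OF c] in auto)
  have int3: "norm_integrable gauss_seq (\<lambda>\<omega>. ?R \<omega> *\<^sub>R ?F \<omega> + (?F \<omega> + gsum n h \<omega> *\<^sub>R ?F \<omega>))"
    by (intro norm_integrable_add intR norm_integrable_f norm_integrable_gsum_f)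
  have "smooth_n n e f (x + (\<Sum>i<n. h i *\<^sub>R e i))
      = weak_integral gauss_seq (\<lambda>\<omega>. ?R \<omega> *\<^sub>R ?F \<omega> + (?F \<omega> + gsum n h \<omega> *\<^sub>R ?F \<omega>))"
    unfolding smooth_n_def
  proof (rule weak_integral_eqI[OF norm_integrable_f])
    fix y
    have "(\<integral>\<omega>. f (x + (\<Sum>i<n. h i *\<^sub>R e i) + gsum n e \<omega>) \<bullet> y \<partial>gauss_seq)
        = (\<integral>\<omega>. ?F (shift n h \<omega>) \<bullet> y \<partial>gauss_seq)"
      by (simp add: gsum_shift ac_simps)
    also have "\<dots> = (\<integral>\<omega>. cm_density n h \<omega> * (?F \<omega> \<bullet> y) \<partial>gauss_seq)"
      by (rule integral_shift) simp
    also have "\<dots> = (\<integral>\<omega>. (?R \<omega> *\<^sub>R ?F \<omega> + (?F \<omega> + gsum n h \<omega> *\<^sub>R ?F \<omega>)) \<bullet> y \<partial>gauss_seq)"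
      by (simp add: inner_add_left algebra_simps)
    finally show "(\<integral>\<omega>. f (x + (\<Sum>i<n. h i *\<^sub>R e i) + gsum n e \<omega>) \<bullet> y \<partial>gauss_seq)
        = weak_integral gauss_seq (\<lambda>\<omega>. ?R \<omega> *\<^sub>R ?F \<omega> + (?F \<omega> + gsum n h \<omega> *\<^sub>R ?F \<omega>)) \<bullet> y"
      unfolding weak_integral_inner[OF int3] .
  qed
  also have "\<dots> = weak_integral gauss_seq (\<lambda>\<omega>. ?R \<omega> *\<^sub>R ?F \<omega>) + smooth_n n e f x + smooth_deriv_n n e f x h"
    by (subst weak_integral_add[OF intR norm_integrable_add[OF norm_integrable_f norm_integrable_gsum_f]],
        subst weak_integral_add[OF norm_integrable_f norm_integrable_gsum_f])
      (simp add: smooth_n_def smooth_deriv_n_def)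
  finally have "norm (smooth_n n e f (x + (\<Sum>i<n. h i *\<^sub>R e i)) - smooth_n n e f x - smooth_deriv_n n e f x h)
      = norm (weak_integral gauss_seq (\<lambda>\<omega>. ?R \<omega> *\<^sub>R ?F \<omega>))"
    by simp
  also have "\<dots> \<le> (\<integral>\<omega>. B * \<bar>?R \<omega>\<bar> \<partial>gauss_seq)"
  proof (rule norm_weak_integral_le[OF intR])
    show "norm (?R \<omega> *\<^sub>R ?F \<omega>) \<le> B * \<bar>?R \<omega>\<bar>" for \<omega>
      using mult_left_mono[OF f_le, of "\<bar>?R \<omega>\<bar>"] by (simp add: mult.commute)
  qed (use cm_density_remainder(1)[OF c] in auto)
  also have "\<dots> \<le> B * (\<Sum>i<n. (h i)\<^sup>2)"
    using cm_density_remainder(2)[OF c] B_nonneg by (simp add: mult_left_mono)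
  finally show ?thesis .
qed

lemma smooth_deriv_n_add:
  "smooth_deriv_n n e f x (\<lambda>i. h i + k i) = smooth_deriv_n n e f x h + smooth_deriv_n n e f x k"
  unfolding smooth_deriv_n_def
  by (subst weak_integral_add[symmetric, OF norm_integrable_gsum_f norm_integrable_gsum_f])
    (simp add: gsum_def algebra_simps sum.distrib flip: scaleR_add_left)

lemma smooth_deriv_n_scale:
  "smooth_deriv_n n e f x (\<lambda>i. c * h i) = c *\<^sub>R smooth_deriv_n n e f x h"
  unfolding smooth_deriv_n_def
  by (subst weak_integral_scaleR[symmetric, OF norm_integrable_gsum_f])
    (simp add: gsum_def sum_distrib_left mult.left_commute)

text \<open>A Chebyshev argument written pointwise: either the tail of the displacement is shorter
  than \<delta>, or the increment, at most \<open>2 * B\<close>, is paid for by the squared tail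
  over \<open>\<delta>\<^sup>2\<close>.\<close>

lemma smooth_n_cauchy:
  assumes \<delta>: "\<delta> > 0" "\<And>x y. dist x y < \<delta> \<Longrightarrow> norm (f x - f y) \<le> \<epsilon>" and nm: "n \<le> m"
  shows "norm (smooth_n m e f x - smooth_n n e f x) \<le> \<epsilon> + 2 * B / \<delta>\<^sup>2 * (\<Sum>i\<in>{n..<m}. (norm (e i))\<^sup>2)"
proof -
  \<comment> \<open>Zeroing the first \<open>n\<close> vectors makes the tail a \<open>gsum\<close>
    of length \<open>m\<close>, so that its second moment is already known.\<close>
  define e' where "e' i = (if i < n then 0 else e i)" for i
  have diff: "gsum m e \<omega> = gsum n e \<omega> + gsum m e' \<omega>" for \<omega>
  proof -
    have "gsum m e \<omega> = (\<Sum>i<m. if i < n then \<omega> i *\<^sub>R e i else 0) + gsum m e' \<omega>"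
      unfolding gsum_def sum.distrib[symmetric] by (rule sum.cong) (auto simp: e'_def)
    also have "(\<Sum>i<m. if i < n then \<omega> i *\<^sub>R e i else 0) = gsum n e \<omega>"
      unfolding gsum_def using nm by (intro sum.mono_neutral_cong_right) auto
    finally show ?thesis .
  qed
  have e': "(\<Sum>i<m. (norm (e' i))\<^sup>2) = (\<Sum>i\<in>{n..<m}. (norm (e i))\<^sup>2)"
    by (rule sum.mono_neutral_cong_right) (auto simp: e'_def)
  have \<epsilon>: "0 \<le> \<epsilon>"
    using \<delta>(2)[of 0 0] \<delta>(1) by simp
  let ?D = "\<lambda>\<omega>. \<epsilon> + 2 * B / \<delta>\<^sup>2 * (norm (gsum m e' \<omega>))\<^sup>2"
  have "norm (smooth_n m e f x - smooth_n n e f x) \<le> (\<integral>\<omega>. ?D \<omega> \<partial>gauss_seq)"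
    unfolding smooth_n_def weak_integral_diff[OF norm_integrable_f norm_integrable_f, symmetric]
  proof (rule norm_weak_integral_le)
    show "norm (f (x + gsum m e \<omega>) - f (x + gsum n e \<omega>)) \<le> ?D \<omega>" for \<omega>
    proof (cases "norm (gsum m e' \<omega>) < \<delta>")
      case True
      then have "norm (f (x + gsum m e \<omega>) - f (x + gsum n e \<omega>)) \<le> \<epsilon>"
        by (intro \<delta>(2)) (simp add: dist_norm diff)
      moreover have "0 \<le> 2 * B / \<delta>\<^sup>2 * (norm (gsum m e' \<omega>))\<^sup>2"
        using B_nonneg by simp
      ultimately show ?thesis by linarith
    next
      case False
      have "norm (f (x + gsum m e \<omega>) - f (x + gsum n e \<omega>)) \<le> 2 * B * 1"
        using norm_triangle_ineq4[of "f (x + gsum m e \<omega>)" "f (x + gsum n e \<omega>)"]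
          f_le[of "x + gsum m e \<omega>"] f_le[of "x + gsum n e \<omega>"] by linarith
      also have "\<dots> \<le> 2 * B * ((norm (gsum m e' \<omega>))\<^sup>2 / \<delta>\<^sup>2)"
        using B_nonneg \<delta>(1) False power_mono[of \<delta> "norm (gsum m e' \<omega>)" 2]
        by (intro mult_left_mono) auto
      finally show ?thesis using \<epsilon> by simp
    qed
  qed (use norm_integrable_diff[OF norm_integrable_f norm_integrable_f] integrable_norm_gsum[of m e'] in auto)
  also have "\<dots> = \<epsilon> + 2 * B / \<delta>\<^sup>2 * (\<Sum>i\<in>{n..<m}. (norm (e i))\<^sup>2)"
    using integrable_norm_gsum[of m e'] integral_norm_gsum[of m e'] gauss_seq.prob_space
    by (simp add: e')
  finally show ?thesis .
qed

context
  fixes L \<alpha> :: real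
  assumes \<alpha>: "0 < \<alpha>" "\<alpha> < 1" and f_holder: "\<And>x y. norm (f x - f y) \<le> L * dist x y powr \<alpha>"
    and L: "0 \<le> L"
begin

text \<open>The free length \<tau> makes the displacement dimensionless before its power is compared
  with the square. Later \<tau> is the smoothing parameter, and the quotient becomes independent of
  it.\<close>

lemma smooth_n_approx:
  assumes \<tau>: "0 < \<tau>"
  shows "norm (f x - smooth_n n e f x) \<le> L * \<tau> powr \<alpha> * (1 + (\<Sum>i<n. (norm (e i))\<^sup>2) / \<tau>\<^sup>2)"
proof -
  have const: "norm_integrable gauss_seq (\<lambda>_. f x)"
    by (rule norm_integrable_bound[where B = "\<lambda>_. B"]) (simp_all add: f_le)
  have "weak_integral gauss_seq (\<lambda>_. f x) = f x"
    by (rule weak_integral_eqI[OF const]) (simp add: gauss_seq.prob_space)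
  then have "norm (f x - smooth_n n e f x) = norm (weak_integral gauss_seq (\<lambda>\<omega>. f x - f (x + gsum n e \<omega>)))"
    by (subst weak_integral_diff[OF const norm_integrable_f]) (simp add: smooth_n_def)
  also have "\<dots> \<le> (\<integral>\<omega>. L * \<tau> powr \<alpha> * (1 + (norm (gsum n e \<omega>))\<^sup>2 / \<tau>\<^sup>2) \<partial>gauss_seq)"
  proof (rule norm_weak_integral_le[OF norm_integrable_diff[OF const norm_integrable_f]])
    fix \<omega>
    have "norm (gsum n e \<omega>) powr \<alpha> = \<tau> powr \<alpha> * (norm (gsum n e \<omega>) / \<tau>) powr \<alpha>"
      using \<tau> by (simp flip: powr_mult)
    also have "\<dots> \<le> \<tau> powr \<alpha> * (1 + (norm (gsum n e \<omega>) / \<tau>)\<^sup>2)"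
      using \<tau> \<alpha> by (intro mult_left_mono powr_le_1_plus_square) auto
    finally have "L * norm (gsum n e \<omega>) powr \<alpha> \<le> L * (\<tau> powr \<alpha> * (1 + (norm (gsum n e \<omega>) / \<tau>)\<^sup>2))"
      by (rule mult_left_mono[OF _ L])
    then show "norm (f x - f (x + gsum n e \<omega>)) \<le> L * \<tau> powr \<alpha> * (1 + (norm (gsum n e \<omega>))\<^sup>2 / \<tau>\<^sup>2)"
      using f_holder[of x "x + gsum n e \<omega>"] by (simp add: dist_norm power_divide mult.assoc)
  qed (use integrable_norm_gsum[of n e] in auto)
  also have "\<dots> = L * \<tau> powr \<alpha> * (1 + (\<Sum>i<n. (norm (e i))\<^sup>2) / \<tau>\<^sup>2)"
    using integrable_norm_gsum[of n e] integral_norm_gsum[of n e] gauss_seq.prob_space by simp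
  finally show ?thesis .
qed

lemma norm_smooth_deriv_n_le:
  assumes \<tau>: "0 < \<tau>"
  shows "norm (smooth_deriv_n n e f x h)
    \<le> L * \<tau> powr \<alpha> * (sqrt (\<Sum>i<n. (h i)\<^sup>2) * sqrt (1 + (\<Sum>i<n. (norm (e i))\<^sup>2) / \<tau>\<^sup>2))"
proof -
  \<comment> \<open>Dominates \<open>(norm (gsum n e \<omega>) / \<tau>) powr \<alpha>\<close>, yet
    its square has an explicit mean, as Cauchy-Schwarz against \<open>gsum n h\<close>
    requires.\<close>
  let ?W = "\<lambda>\<omega>. sqrt (1 + (norm (gsum n e \<omega>))\<^sup>2 / \<tau>\<^sup>2)"
  have W2: "(?W \<omega>)\<^sup>2 = 1 + (norm (gsum n e \<omega>))\<^sup>2 / \<tau>\<^sup>2" for \<omega>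
    by (simp add: add_nonneg_nonneg)
  have [measurable]: "?W \<in> borel_measurable gauss_seq" by measurable
  have intW: "integrable gauss_seq (\<lambda>\<omega>. (?W \<omega>)\<^sup>2)"
    unfolding W2 using integrable_norm_gsum[of n e] by simp
  have integralW: "(\<integral>\<omega>. (?W \<omega>)\<^sup>2 \<partial>gauss_seq) = 1 + (\<Sum>i<n. (norm (e i))\<^sup>2) / \<tau>\<^sup>2"
    unfolding W2 using integrable_norm_gsum[of n e] integral_norm_gsum[of n e] gauss_seq.prob_space by simp
  have W0: "0 \<le> ?W \<omega>" for \<omega> by (simp add: add_nonneg_nonneg)
  note CS = integral_mult_le_sqrt[of "gsum n h" gauss_seq ?W, OF _ _ integrable_gsum_power2 intW]
  have const: "norm_integrable gauss_seq (\<lambda>\<omega>. gsum n h \<omega> *\<^sub>R f x)"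
  proof (rule norm_integrable_bound[where B = "\<lambda>\<omega>. \<bar>gsum n h \<omega>\<bar> * norm (f x)"])
    show "norm (gsum n h \<omega> *\<^sub>R f x) \<le> \<bar>gsum n h \<omega>\<bar> * norm (f x)" for \<omega>
      by simp
  qed (use integrable_gsum[of n h] in auto)
  have "weak_integral gauss_seq (\<lambda>\<omega>. gsum n h \<omega> *\<^sub>R f x) = 0"
    by (rule weak_integral_eqI[OF const]) (simp add: integral_gsum)
  \<comment> \<open>as \<open>E X = 0\<close>, the value \<open>f x\<close> can be subtracted, which makes the Hoelder bound applicable\<close>
  then have "smooth_deriv_n n e f x h
      = weak_integral gauss_seq (\<lambda>\<omega>. gsum n h \<omega> *\<^sub>R f (x + gsum n e \<omega>) - gsum n h \<omega> *\<^sub>R f x)"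
    by (subst weak_integral_diff[OF norm_integrable_gsum_f const]) (simp add: smooth_deriv_n_def)
  also have "norm \<dots> \<le> (\<integral>\<omega>. L * \<tau> powr \<alpha> * (\<bar>gsum n h \<omega>\<bar> * \<bar>?W \<omega>\<bar>) \<partial>gauss_seq)"
  proof (rule norm_weak_integral_le[OF norm_integrable_diff[OF norm_integrable_gsum_f const]])
    fix \<omega>
    have "(norm (gsum n e \<omega>) / \<tau>) powr \<alpha> \<le> ?W \<omega>"
      by (rule real_le_rsqrt) (use \<tau> \<alpha> powr_le_1_plus_square(2)[of "norm (gsum n e \<omega>) / \<tau>" \<alpha>] in \<open>simp add: power_divide\<close>)
    then have "\<tau> powr \<alpha> * (norm (gsum n e \<omega>) / \<tau>) powr \<alpha> \<le> \<tau> powr \<alpha> * ?W \<omega>"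
      by (rule mult_left_mono) simp
    then have "norm (gsum n e \<omega>) powr \<alpha> \<le> \<tau> powr \<alpha> * ?W \<omega>"
      using \<tau> by (simp flip: powr_mult)
    then have "L * norm (gsum n e \<omega>) powr \<alpha> \<le> L * (\<tau> powr \<alpha> * ?W \<omega>)"
      by (rule mult_left_mono[OF _ L])
    then have "norm (f (x + gsum n e \<omega>) - f x) \<le> L * (\<tau> powr \<alpha> * ?W \<omega>)"
      using f_holder[of "x + gsum n e \<omega>" x] by (simp add: dist_norm)
    then have "\<bar>gsum n h \<omega>\<bar> * norm (f (x + gsum n e \<omega>) - f x) \<le> \<bar>gsum n h \<omega>\<bar> * (L * (\<tau> powr \<alpha> * ?W \<omega>))"
      by (rule mult_left_mono) simp
    then show "norm (gsum n h \<omega> *\<^sub>R f (x + gsum n e \<omega>) - gsum n h \<omega> *\<^sub>R f x) \<le> L * \<tau> powr \<alpha> * (\<bar>gsum n h \<omega>\<bar> * \<bar>?W \<omega>\<bar>)"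
      unfolding abs_of_nonneg[OF W0] scaleR_diff_right[symmetric] norm_scaleR by (simp add: ac_simps)
  qed (use CS(1) in auto)
  also have "\<dots> \<le> L * \<tau> powr \<alpha> * (sqrt (\<Sum>i<n. (h i)\<^sup>2) * sqrt (1 + (\<Sum>i<n. (norm (e i))\<^sup>2) / \<tau>\<^sup>2))"
    using CS(2) L unfolding integral_gsum_power2 integralW by (simp add: mult_left_mono)
  finally show ?thesis .
qed

end

end


section \<open>The limit of infinitely many Gaussian directions\<close>

definition smooth :: "(nat \<Rightarrow> 'h) \<Rightarrow> ('h::real_normed_vector \<Rightarrow> 'j::real_inner) \<Rightarrow> 'h \<Rightarrow> 'j" where
  "smooth e f x = lim (\<lambda>n. smooth_n n e f x)"

definition smooth_deriv ::
  "(nat \<Rightarrow> 'h) \<Rightarrow> ('h::real_normed_vector \<Rightarrow> 'j::real_inner) \<Rightarrow> 'h \<Rightarrow> (nat \<Rightarrow> real) \<Rightarrow> 'j" where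
  "smooth_deriv e f x h = lim (\<lambda>n. smooth_deriv_n n e f x h)"

lemma norm_limit_le:
  fixes X :: "nat \<Rightarrow> 'a::real_normed_vector"
  assumes "X \<longlonglongrightarrow> l" "\<And>n. norm (X n) \<le> b"
  shows "norm l \<le> b"
  using LIMSEQ_le_const2[OF tendsto_norm[OF assms(1)], of b] assms(2) by auto

text \<open>The exchange of limits: \<open>G\<close> will be the derivatives in \<open>n\<close>
  directions and \<open>D\<close> their difference quotients with a fixed step.\<close>

lemma Cauchy_if_close_to_Cauchy:
  fixes G :: "nat \<Rightarrow> 'a::real_normed_vector"
  assumes "\<And>\<epsilon>. \<epsilon> > 0 \<Longrightarrow> \<exists>D. Cauchy D \<and> (\<forall>n. norm (G n - D n) \<le> \<epsilon>)"
  shows "Cauchy G"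
proof (rule CauchyI)
  fix \<epsilon> :: real assume "\<epsilon> > 0"
  then obtain D where D: "Cauchy D" "\<And>n. norm (G n - D n) \<le> \<epsilon> / 4"
    using assms[of "\<epsilon> / 4"] by auto
  obtain M where M: "\<And>m n. m \<ge> M \<Longrightarrow> n \<ge> M \<Longrightarrow> norm (D m - D n) < \<epsilon> / 4"
    using CauchyD[OF D(1), of "\<epsilon> / 4"] \<open>\<epsilon> > 0\<close> by auto
  have "norm (G m - G n) < \<epsilon>" if "m \<ge> M" "n \<ge> M" for m n
  proof -
    have "norm (G m - G n) \<le> norm (G m - D m) + norm (D m - D n) + norm (G n - D n)"
      using norm_triangle_ineq[of "G m - D m + (D m - D n)" "D n - G n"]
        norm_triangle_ineq[of "G m - D m" "D m - D n"]
      by (simp add: norm_minus_commute)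
    then show ?thesis
      using D(2)[of m] D(2)[of n] M[OF that] \<open>\<epsilon> > 0\<close> by linarith
  qed
  then show "\<exists>M. \<forall>m\<ge>M. \<forall>n\<ge>M. norm (G m - G n) < \<epsilon>" by blast
qed

context
  fixes f :: "'h::{real_inner, second_countable_topology} \<Rightarrow> 'j::{real_inner, polish_space}"
    and B :: real and e :: "nat \<Rightarrow> 'h"
  assumes f_unif: "uniformly_continuous_on UNIV f" and f_le: "\<And>x. norm (f x) \<le> B"
    and e_summable: "summable (\<lambda>i. (norm (e i))\<^sup>2)"
begin

lemma f_cont: "continuous_on UNIV f"
  by (rule uniformly_continuous_imp_continuous[OF f_unif])

lemma f_modulus:
  assumes "\<epsilon> > 0"
  obtains \<delta> where "\<delta> > 0" "\<And>x y. dist x y < \<delta> \<Longrightarrow> norm (f x - f y) \<le> \<epsilon>"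
  using f_unif assms unfolding uniformly_continuous_on_def dist_norm
  by (metis UNIV_I less_imp_le norm_minus_commute)

lemma smooth_n_tendsto: "(\<lambda>n. smooth_n n e f x) \<longlonglongrightarrow> smooth e f x"
proof -
  have B: "0 \<le> B" using order_trans[OF norm_ge_zero f_le] .
  have "Cauchy (\<lambda>n. smooth_n n e f x)"
  proof (rule CauchyI')
    fix \<epsilon> :: real assume \<epsilon>: "\<epsilon> > 0"
    then obtain \<delta> where \<delta>: "\<delta> > 0" "\<And>x y. dist x y < \<delta> \<Longrightarrow> norm (f x - f y) \<le> \<epsilon> / 2"
      using f_modulus[of "\<epsilon> / 2"] by auto
    \<comment> \<open>The added 1 keeps the divisor positive when \<open>B = 0\<close>.\<close>
    define C where "C = 2 * B / \<delta>\<^sup>2 + 1"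
    have C: "C > 0" using B by (simp add: C_def add_nonneg_pos)
    obtain N where N: "\<And>m n. m \<ge> N \<Longrightarrow> norm (\<Sum>i\<in>{m..<n}. (norm (e i))\<^sup>2) < \<epsilon> / 2 / C"
      using e_summable[unfolded summable_Cauchy] \<epsilon> C by (metis divide_pos_pos zero_less_numeral)
    have "dist (smooth_n n e f x) (smooth_n m e f x) < \<epsilon>" if "N \<le> n" "n < m" for m n
    proof -
      let ?S = "\<Sum>i\<in>{n..<m}. (norm (e i))\<^sup>2"
      have S: "0 \<le> ?S" by (intro sum_nonneg) simp
      have "2 * B / \<delta>\<^sup>2 * ?S \<le> C * ?S"
        using S by (intro mult_right_mono) (auto simp: C_def)
      also have "\<dots> < \<epsilon> / 2"
        using N[OF that(1), of m] C by (simp add: field_simps S)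
      finally show ?thesis
        using smooth_n_cauchy[OF f_cont f_le \<delta>, of n m e x] that
        by (simp add: dist_norm norm_minus_commute)
    qed
    then show "\<exists>M. \<forall>m\<ge>M. \<forall>n>m. dist (smooth_n m e f x) (smooth_n n e f x) < \<epsilon>" by blast
  qed
  then show ?thesis
    unfolding smooth_def by (simp add: Cauchy_convergent_iff convergent_LIMSEQ_iff)
qed

text \<open>All \<open>smooth_n n e f\<close> inherit the modulus of continuity of \<open>f\<close>,
  so the argument may move with \<open>n\<close>. This matters because the partial sums of a
  direction reach it only in the limit.\<close>

lemma smooth_n_tendsto':
  assumes "y \<longlonglongrightarrow> x"
  shows "(\<lambda>n. smooth_n n e f (y n)) \<longlonglongrightarrow> smooth e f x"
proof -
  have "(\<lambda>n. smooth_n n e f (y n) - smooth_n n e f x) \<longlonglongrightarrow> 0"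
  proof (rule metric_LIMSEQ_I)
    fix \<epsilon> :: real assume \<epsilon>: "\<epsilon> > 0"
    then obtain \<delta> where \<delta>: "\<delta> > 0" "\<And>x y. dist x y < \<delta> \<Longrightarrow> norm (f x - f y) \<le> \<epsilon> / 2"
      using f_modulus[of "\<epsilon> / 2"] by auto
    obtain N where N: "\<And>n. n \<ge> N \<Longrightarrow> dist (y n) x < \<delta>"
      using metric_LIMSEQ_D[OF assms \<delta>(1)] by auto
    have "dist (smooth_n n e f (y n) - smooth_n n e f x) 0 < \<epsilon>" if "n \<ge> N" for n
    proof -
      have "norm (smooth_n n e f (y n) - smooth_n n e f x) \<le> \<epsilon> / 2"
        by (intro smooth_n_diff_le[OF f_cont f_le] \<delta>(2)) (use N[OF that] in \<open>simp add: dist_norm\<close>)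
      then show ?thesis using \<epsilon> by (simp add: dist_norm)
    qed
    then show "\<exists>N. \<forall>n\<ge>N. dist (smooth_n n e f (y n) - smooth_n n e f x) 0 < \<epsilon>" by blast
  qed
  from tendsto_add[OF this smooth_n_tendsto[of x]] show ?thesis by simp
qed

lemma norm_smooth_le: "norm (smooth e f x) \<le> B"
  by (rule norm_limit_le[OF smooth_n_tendsto]) (rule norm_smooth_n_le[OF f_cont f_le])

lemma smooth_diff_le:
  assumes "\<And>z. norm (f (x + z) - f (y + z)) \<le> d"
  shows "norm (smooth e f x - smooth e f y) \<le> d"
  by (rule norm_limit_le[OF tendsto_diff[OF smooth_n_tendsto smooth_n_tendsto]])
    (rule smooth_n_diff_le[OF f_cont f_le assms])

lemma smooth_unif: "uniformly_continuous_on UNIV (smooth e f)"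
  unfolding uniformly_continuous_on_def
proof (intro allI impI)
  fix \<epsilon> :: real assume \<epsilon>: "\<epsilon> > 0"
  then obtain \<delta> where \<delta>: "\<delta> > 0" "\<And>x y. dist x y < \<delta> \<Longrightarrow> norm (f x - f y) \<le> \<epsilon> / 2"
    using f_modulus[of "\<epsilon> / 2"] by auto
  have "dist (smooth e f x') (smooth e f x) < \<epsilon>" if "dist x' x < \<delta>" for x x'
  proof -
    have "norm (smooth e f x' - smooth e f x) \<le> \<epsilon> / 2"
      by (intro smooth_diff_le \<delta>(2)) (use that in \<open>simp add: dist_norm\<close>)
    then show ?thesis using \<epsilon> by (simp add: dist_norm)
  qed
  then show "\<exists>d>0. \<forall>x\<in>UNIV. \<forall>x'\<in>UNIV. dist x' x < d \<longrightarrow> dist (smooth e f x') (smooth e f x) < \<epsilon>"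
    using \<delta>(1) by blast
qed

lemma smooth_approx:
  assumes "0 < \<alpha>" "\<alpha> < 1" "\<And>x y. norm (f x - f y) \<le> L * dist x y powr \<alpha>" "0 \<le> L" "0 < \<tau>"
  shows "norm (f x - smooth e f x) \<le> L * \<tau> powr \<alpha> * (1 + (\<Sum>i. (norm (e i))\<^sup>2) / \<tau>\<^sup>2)"
proof (rule norm_limit_le[OF tendsto_diff[OF tendsto_const smooth_n_tendsto]])
  fix n
  have "norm (f x - smooth_n n e f x) \<le> L * \<tau> powr \<alpha> * (1 + (\<Sum>i<n. (norm (e i))\<^sup>2) / \<tau>\<^sup>2)"
    by (rule smooth_n_approx[OF f_cont f_le assms])
  also have "\<dots> \<le> L * \<tau> powr \<alpha> * (1 + (\<Sum>i. (norm (e i))\<^sup>2) / \<tau>\<^sup>2)"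
    using assms(4) sum_le_suminf[OF e_summable, of "{..<n}"]
    by (intro mult_left_mono add_mono divide_right_mono) auto
  finally show "norm (f x - smooth_n n e f x) \<le> L * \<tau> powr \<alpha> * (1 + (\<Sum>i. (norm (e i))\<^sup>2) / \<tau>\<^sup>2)" .
qed

context
  fixes h :: "nat \<Rightarrow> real" and k :: 'h
  assumes h_summable: "summable (\<lambda>i. (h i)\<^sup>2)" and h_sums: "(\<lambda>i. h i *\<^sub>R e i) sums k"
begin

lemma smooth_deriv_n_tendsto: "(\<lambda>n. smooth_deriv_n n e f x h) \<longlonglongrightarrow> smooth_deriv e f x h"
proof -
  let ?c = "\<Sum>i. (h i)\<^sup>2"
  have B: "0 \<le> B" using order_trans[OF norm_ge_zero f_le] .
  have c: "0 \<le> ?c" using h_summable by (intro suminf_nonneg) auto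
  have part: "(\<Sum>i<n. (h i)\<^sup>2) \<le> ?c" for n
    using h_summable by (intro sum_le_suminf) auto
  have "Cauchy (\<lambda>n. smooth_deriv_n n e f x h)"
  proof (rule Cauchy_if_close_to_Cauchy)
    fix \<epsilon> :: real assume \<epsilon>: "\<epsilon> > 0"
    \<comment> \<open>The first entry makes the squared coordinates of the step
      \<open>s * h i\<close> sum to at most 1, as the remainder bound demands; the second makes the
      error of the quotient, \<open>B * s * ?c\<close>, at most \<epsilon>. The summands 1 guard
      against zero denominators.\<close>
    define s where "s = min (1 / (1 + ?c)) (\<epsilon> / (B * ?c + 1))"
    have s0: "s > 0" using \<epsilon> B c by (simp add: s_def add_pos_nonneg add_nonneg_pos)
    have "s * (1 + ?c) \<le> 1" "s * (B * ?c + 1) \<le> \<epsilon>"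
      using c B by (simp_all add: s_def add_pos_nonneg add_nonneg_pos flip: pos_le_divide_eq)
    moreover have "0 \<le> s * ?c"
      using s0 c by simp
    ultimately have sc: "s * ?c \<le> 1" "s \<le> 1" "s * (B * ?c) \<le> \<epsilon>"
      using s0 unfolding distrib_left mult_1_right by linarith+
    \<comment> \<open>difference quotients with a fixed small step converge as \<open>n \<rightarrow> \<infinity>\<close> and are close to the
      derivatives, uniformly in \<open>n\<close>\<close>
    let ?D = "\<lambda>n. (smooth_n n e f (x + (\<Sum>i<n. (s * h i) *\<^sub>R e i)) - smooth_n n e f x) /\<^sub>R s"
    have "(\<lambda>n. \<Sum>i<n. (s * h i) *\<^sub>R e i) \<longlonglongrightarrow> s *\<^sub>R k"
      using sums_scaleR_right[OF h_sums, of s] by (simp add: sums_def)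
    then have "(\<lambda>n. x + (\<Sum>i<n. (s * h i) *\<^sub>R e i)) \<longlonglongrightarrow> x + s *\<^sub>R k"
      by (intro tendsto_add tendsto_const)
    from smooth_n_tendsto'[OF this] have "?D \<longlonglongrightarrow> (smooth e f (x + s *\<^sub>R k) - smooth e f x) /\<^sub>R s"
      by (intro tendsto_scaleR tendsto_const tendsto_diff smooth_n_tendsto)
    then have "Cauchy ?D"
      by (rule LIMSEQ_imp_Cauchy)
    moreover have "norm (smooth_deriv_n n e f x h - ?D n) \<le> \<epsilon>" for n
    proof -
      have eq: "(\<Sum>i<n. (s * h i)\<^sup>2) = s * (s * (\<Sum>i<n. (h i)\<^sup>2))"
        by (simp add: sum_distrib_left power2_eq_square ac_simps)
      have le: "s * (\<Sum>i<n. (h i)\<^sup>2) \<le> s * ?c"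
        using part s0 by (intro mult_left_mono) auto
      have "s * (s * (\<Sum>i<n. (h i)\<^sup>2)) \<le> 1 * 1"
        using s0 by (intro mult_mono sc(2) order_trans[OF le sc(1)] mult_nonneg_nonneg sum_nonneg) auto
      then have rem: "norm (smooth_n n e f (x + (\<Sum>i<n. (s * h i) *\<^sub>R e i)) - smooth_n n e f x
          - s *\<^sub>R smooth_deriv_n n e f x h) \<le> B * (s * (s * (\<Sum>i<n. (h i)\<^sup>2)))"
        using smooth_n_remainder[OF f_cont f_le, where n = n and h = "\<lambda>i. s * h i"]
        by (simp only: eq smooth_deriv_n_scale[OF f_cont f_le])
      have "norm (smooth_deriv_n n e f x h - ?D n)
          = norm ((smooth_n n e f (x + (\<Sum>i<n. (s * h i) *\<^sub>R e i)) - smooth_n n e f x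
          - s *\<^sub>R smooth_deriv_n n e f x h) /\<^sub>R s)"
        using s0 by (subst norm_minus_commute) (simp add: scaleR_diff_right)
      also have "\<dots> \<le> B * (s * (\<Sum>i<n. (h i)\<^sup>2))"
      proof -
        have "norm (Z /\<^sub>R s) \<le> B * (s * (\<Sum>i<n. (h i)\<^sup>2))"
          if "norm Z \<le> B * (s * (s * (\<Sum>i<n. (h i)\<^sup>2)))" for Z :: 'j
          using that s0 by (simp add: field_simps)
        then show ?thesis using rem by blast
      qed
      also have "\<dots> \<le> B * (s * ?c)"
        by (rule mult_left_mono[OF le B])
      also have "\<dots> \<le> \<epsilon>" using sc(3) by (simp add: mult.left_commute)
      finally show ?thesis .
    qed
    ultimately show "\<exists>D. Cauchy D \<and> (\<forall>n. norm (smooth_deriv_n n e f x h - D n) \<le> \<epsilon>)" by blast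
  qed
  then show ?thesis
    unfolding smooth_deriv_def by (simp add: Cauchy_convergent_iff convergent_LIMSEQ_iff)
qed

lemma smooth_remainder:
  assumes c: "(\<Sum>i. (h i)\<^sup>2) \<le> 1"
  shows "norm (smooth e f (x + k) - smooth e f x - smooth_deriv e f x h) \<le> B * (\<Sum>i. (h i)\<^sup>2)"
proof -
  have B: "0 \<le> B" using order_trans[OF norm_ge_zero f_le] .
  have part: "(\<Sum>i<n. (h i)\<^sup>2) \<le> (\<Sum>i. (h i)\<^sup>2)" for n
    using h_summable by (intro sum_le_suminf) auto
  have "(\<lambda>n. x + (\<Sum>i<n. h i *\<^sub>R e i)) \<longlonglongrightarrow> x + k"
    using h_sums by (intro tendsto_add tendsto_const) (simp add: sums_def)
  from smooth_n_tendsto'[OF this] show ?thesis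
  proof (intro norm_limit_le[OF tendsto_diff[OF tendsto_diff[OF _ smooth_n_tendsto] smooth_deriv_n_tendsto]])
    fix n
    show "norm (smooth_n n e f (x + (\<Sum>i<n. h i *\<^sub>R e i)) - smooth_n n e f x - smooth_deriv_n n e f x h)
        \<le> B * (\<Sum>i. (h i)\<^sup>2)"
      by (rule order_trans[OF smooth_n_remainder[OF f_cont f_le order_trans[OF part c]] mult_left_mono[OF part B]])
  qed
qed

lemma smooth_deriv_diff_le:
  assumes "\<And>z. norm (f (x + z) - f (y + z)) \<le> d"
  shows "norm (smooth_deriv e f x h - smooth_deriv e f y h) \<le> d * sqrt (\<Sum>i. (h i)\<^sup>2)"
proof (rule norm_limit_le[OF tendsto_diff[OF smooth_deriv_n_tendsto smooth_deriv_n_tendsto]])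
  fix n
  have d: "0 \<le> d" using order_trans[OF norm_ge_zero assms] .
  have "d * sqrt (\<Sum>i<n. (h i)\<^sup>2) \<le> d * sqrt (\<Sum>i. (h i)\<^sup>2)"
    using h_summable d by (intro mult_left_mono real_sqrt_le_mono sum_le_suminf) auto
  then show "norm (smooth_deriv_n n e f x h - smooth_deriv_n n e f y h) \<le> d * sqrt (\<Sum>i. (h i)\<^sup>2)"
    using smooth_deriv_n_diff_le[OF f_cont f_le assms, of n e h] by linarith
qed

lemma norm_smooth_deriv_le:
  assumes "0 < \<alpha>" "\<alpha> < 1" "\<And>x y. norm (f x - f y) \<le> L * dist x y powr \<alpha>" "0 \<le> L" "0 < \<tau>"
  shows "norm (smooth_deriv e f x h)
    \<le> L * \<tau> powr \<alpha> * (sqrt (\<Sum>i. (h i)\<^sup>2) * sqrt (1 + (\<Sum>i. (norm (e i))\<^sup>2) / \<tau>\<^sup>2))"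
proof (rule norm_limit_le[OF smooth_deriv_n_tendsto])
  fix n
  have "norm (smooth_deriv_n n e f x h)
      \<le> L * \<tau> powr \<alpha> * (sqrt (\<Sum>i<n. (h i)\<^sup>2) * sqrt (1 + (\<Sum>i<n. (norm (e i))\<^sup>2) / \<tau>\<^sup>2))"
    by (rule norm_smooth_deriv_n_le[OF f_cont f_le assms])
  also have "\<dots> \<le> L * \<tau> powr \<alpha> * (sqrt (\<Sum>i. (h i)\<^sup>2) * sqrt (1 + (\<Sum>i. (norm (e i))\<^sup>2) / \<tau>\<^sup>2))"
    using assms(4,5) h_summable e_summable
    by (intro mult_left_mono mult_mono real_sqrt_le_mono add_mono divide_right_mono sum_le_suminf)
      (auto intro!: add_nonneg_nonneg divide_nonneg_nonneg sum_nonneg suminf_nonneg)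
  finally show "norm (smooth_deriv_n n e f x h)
      \<le> L * \<tau> powr \<alpha> * (sqrt (\<Sum>i. (h i)\<^sup>2) * sqrt (1 + (\<Sum>i. (norm (e i))\<^sup>2) / \<tau>\<^sup>2))" .
qed

lemma smooth_deriv_scale: "smooth_deriv e f x (\<lambda>i. c * h i) = c *\<^sub>R smooth_deriv e f x h"
  unfolding smooth_deriv_def[of e f x "\<lambda>i. c * h i"] smooth_deriv_n_scale[OF f_cont f_le]
  by (intro limI tendsto_scaleR tendsto_const smooth_deriv_n_tendsto)

end

lemma smooth_deriv_add:
  assumes "summable (\<lambda>i. (h i)\<^sup>2)" "(\<lambda>i. h i *\<^sub>R e i) sums k"
    and "summable (\<lambda>i. (h' i)\<^sup>2)" "(\<lambda>i. h' i *\<^sub>R e i) sums k'"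
  shows "smooth_deriv e f x (\<lambda>i. h i + h' i) = smooth_deriv e f x h + smooth_deriv e f x h'"
  unfolding smooth_deriv_def[of e f x "\<lambda>i. h i + h' i"] smooth_deriv_n_add[OF f_cont f_le]
  by (intro limI tendsto_add smooth_deriv_n_tendsto[OF assms(1,2)] smooth_deriv_n_tendsto[OF assms(3,4)])

end


section \<open>Self-adjoint and trace class operators\<close>

lemma linear_op_diff:
  assumes "linear_op D A" "x \<in> D" "y \<in> D"
  shows "A (x - y) = A x - A y"
proof -
  have "A (x + (-1) *\<^sub>R y) = A x + (-1) *\<^sub>R A y"
    using assms unfolding linear_op_def by (metis subspace_scale)
  then show ?thesis by simp
qed

lemma self_adjoint_op_symmetric:
  assumes "self_adjoint_op D A" "u \<in> D" "v \<in> D"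
  shows "A u \<bullet> v = u \<bullet> A v"
  using assms unfolding self_adjoint_op_def by blast

lemma coercive_lower_bound:
  fixes A :: "'a::real_inner \<Rightarrow> 'a"
  assumes "A u \<bullet> u \<ge> m * (norm u)\<^sup>2"
  shows "m * norm u \<le> norm (A u)"
proof (cases "u = 0")
  case False
  have "m * norm u * norm u \<le> norm (A u) * norm u"
    using assms norm_cauchy_schwarz[of "A u" u] by (simp add: power2_eq_square mult.assoc)
  then show ?thesis using False by simp
qed simp

text \<open>Coercivity bounds \<open>A\<close> from below, which gives injectivity and, as a
  self-adjoint operator has closed graph, a closed range. A vector orthogonal to the range lies in
  the kernel of the adjoint, which is the kernel of \<open>A\<close> and hence zero.\<close>

lemma self_adjoint_op_coercive_bij:
  fixes A :: "'a::{real_inner, polish_space} \<Rightarrow> 'a"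
  assumes A: "self_adjoint_op D A" and m: "m > 0" "\<forall>u\<in>D. A u \<bullet> u \<ge> m * (norm u)\<^sup>2"
  shows "bij_betw A D UNIV"
proof -
  have lin: "linear_op D A" using A by (simp add: self_adjoint_op_def)
  then have D: "subspace D" by (simp add: linear_op_def)
  \<comment> \<open>The maximality half of self-adjointness: membership in \<open>D\<close> is a
    conclusion here. It provides both closedness of the graph and the identification of the kernel
    of the adjoint.\<close>
  have adj: "u \<in> D \<and> A u = w" if "\<And>v. v \<in> D \<Longrightarrow> A v \<bullet> u = v \<bullet> w" for u w
    using A that unfolding self_adjoint_op_def by blast
  have lower: "m * norm (u - v) \<le> norm (A u - A v)" if "u \<in> D" "v \<in> D" for u v
    using coercive_lower_bound[of m "u - v" A] bspec[OF m(2), of "u - v"] that D linear_op_diff[OF lin that]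
    by (simp add: subspace_diff)
  have "inj_on A D"
  proof (rule inj_onI)
    fix u v assume "u \<in> D" "v \<in> D" "A u = A v"
    with lower[of u v] m(1) show "u = v" by (simp add: mult_le_0_iff)
  qed
  moreover have "closed (A ` D)"
    unfolding closed_sequential_limits
  proof (intro allI impI, elim conjE)
    fix x l assume x: "\<forall>n. x n \<in> A ` D" "x \<longlonglongrightarrow> l"
    then obtain u where u: "\<And>n. u n \<in> D" "\<And>n. x n = A (u n)"
      unfolding image_iff Bex_def by metis
    have "Cauchy u"
    proof (rule CauchyI)
      fix \<epsilon> :: real assume "\<epsilon> > 0"
      then obtain M where M: "\<And>i j. i \<ge> M \<Longrightarrow> j \<ge> M \<Longrightarrow> norm (x i - x j) < m * \<epsilon>"
        using CauchyD[OF LIMSEQ_imp_Cauchy[OF x(2)], of "m * \<epsilon>"] m(1) by auto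
      have "norm (u i - u j) < \<epsilon>" if "i \<ge> M" "j \<ge> M" for i j
      proof -
        have "m * norm (u i - u j) < m * \<epsilon>"
          using lower[OF u(1)[of i] u(1)[of j]] M[OF that] by (simp add: u(2))
        then show ?thesis using m(1) by simp
      qed
      then show "\<exists>M. \<forall>i\<ge>M. \<forall>j\<ge>M. norm (u i - u j) < \<epsilon>" by blast
    qed
    then obtain v where v: "u \<longlonglongrightarrow> v"
      unfolding Cauchy_convergent_iff convergent_def by blast
    have "v \<in> D \<and> A v = l"
    proof (rule adj)
      fix w assume w: "w \<in> D"
      have "(\<lambda>n. A w \<bullet> u n) \<longlonglongrightarrow> A w \<bullet> v"
        by (intro tendsto_inner tendsto_const v)
      moreover have "(\<lambda>n. A w \<bullet> u n) \<longlonglongrightarrow> w \<bullet> l"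
        unfolding self_adjoint_op_symmetric[OF A w u(1)] u(2)[symmetric]
        by (intro tendsto_inner tendsto_const x(2))
      ultimately show "A w \<bullet> v = w \<bullet> l" by (rule LIMSEQ_unique)
    qed
    then show "l \<in> A ` D" by auto
  qed
  moreover have "subspace (A ` D)"
    unfolding subspace_def
  proof (intro conjI ballI allI)
    have "A (0 *\<^sub>R 0) = 0 *\<^sub>R A 0"
      using lin D unfolding linear_op_def by (metis subspace_0)
    then show "0 \<in> A ` D"
      using D by (metis image_eqI scaleR_zero_left subspace_0)
  next
    fix x y assume "x \<in> A ` D" "y \<in> A ` D"
    then obtain u v where "x = A u" "u \<in> D" "y = A v" "v \<in> D" by blast
    then have "x + y = A (u + v)" "u + v \<in> D"
      using lin D by (auto simp: linear_op_def subspace_add)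
    then show "x + y \<in> A ` D" by blast
  next
    fix c x assume "x \<in> A ` D"
    then obtain u where "x = A u" "u \<in> D" by blast
    then have "c *\<^sub>R x = A (c *\<^sub>R u)" "c *\<^sub>R u \<in> D"
      using lin D by (auto simp: linear_op_def subspace_scale)
    then show "c *\<^sub>R x \<in> A ` D" by blast
  qed
  moreover have "x \<in> A ` D" if R: "subspace (A ` D)" "closed (A ` D)" for x
  proof -
    obtain p where p: "p \<in> A ` D" "\<And>r. r \<in> A ` D \<Longrightarrow> (x - p) \<bullet> r = 0"
      using ex_orthogonal_projection[OF R, of x] by blast
    have "x - p \<in> D \<and> A (x - p) = 0"
      by (rule adj) (use p(2) in \<open>simp add: inner_commute\<close>)
    with bspec[OF m(2), of "x - p"] m(1) have "x - p = 0" by (simp add: mult_le_0_iff)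
    with p(1) show ?thesis by simp
  qed
  ultimately show ?thesis
    unfolding bij_betw_def by blast
qed

text \<open>In the nuclear representation, Cauchy-Schwarz and Bessel bound the contribution of the
  \<open>n\<close>-th term to any finite part of the trace by
  \<open>norm (a n) * norm (b n)\<close>.\<close>

lemma trace_class_op_summable:
  assumes T: "trace_class_op T" and g: "orthonormal0 g" and nonneg: "\<And>i. 0 \<le> g i \<bullet> T (g i)"
  shows "summable (\<lambda>i. g i \<bullet> T (g i))"
proof -
  obtain a b where ab: "summable (\<lambda>n::nat. norm (a n) * norm (b n))"
    and Tx: "\<And>x. (\<lambda>n. (a n \<bullet> x) *\<^sub>R b n) sums T x"
    using T unfolding trace_class_op_def by blast
  have bound: "(\<Sum>i<N. g i \<bullet> T (g i)) \<le> (\<Sum>n. norm (a n) * norm (b n))" for N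
  proof (rule sums_le[OF _ _ summable_sums[OF ab]])
    show "(\<lambda>n. \<Sum>i<N. (a n \<bullet> g i) * (b n \<bullet> g i)) sums (\<Sum>i<N. g i \<bullet> T (g i))"
    proof (rule sums_sum)
      fix i
      have "(\<lambda>n. g i \<bullet> ((a n \<bullet> g i) *\<^sub>R b n)) sums (g i \<bullet> T (g i))"
        by (rule bounded_linear.sums[OF bounded_linear_inner_right Tx])
      then show "(\<lambda>n. (a n \<bullet> g i) * (b n \<bullet> g i)) sums (g i \<bullet> T (g i))"
        by (simp add: inner_commute)
    qed
    fix n
    have "(\<Sum>i<N. (a n \<bullet> g i) * (b n \<bullet> g i))\<^sup>2 \<le> (\<Sum>i<N. (a n \<bullet> g i)\<^sup>2) * (\<Sum>i<N. (b n \<bullet> g i)\<^sup>2)"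
      by (rule Cauchy_Schwarz_ineq_sum)
    also have "\<dots> \<le> (norm (a n))\<^sup>2 * (norm (b n))\<^sup>2"
      by (intro mult_mono orthonormal0_bessel_finite[OF g] sum_nonneg) auto
    finally show "(\<Sum>i<N. (a n \<bullet> g i) * (b n \<bullet> g i)) \<le> norm (a n) * norm (b n)"
      unfolding power_mult_distrib[symmetric] by (rule power2_le_imp_le) simp
  qed
  show ?thesis
  proof (rule bounded_imp_summable)
    show "(\<Sum>i\<le>n. g i \<bullet> T (g i)) \<le> (\<Sum>n. norm (a n) * norm (b n))" for n
      using bound[of "Suc n"] unfolding lessThan_Suc_atMost .
  qed (rule nonneg)
qed

text \<open>Merges the families for the two components of K into one sequence, since the Gaussian
  coordinates are indexed by natural numbers.\<close>

definition interleave :: "(nat \<Rightarrow> 'a) \<Rightarrow> (nat \<Rightarrow> 'a) \<Rightarrow> nat \<Rightarrow> 'a" where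
  "interleave a b n = (if even n then a (n div 2) else b (n div 2))"

text \<open>Convergence in norm suffices: an odd partial sum exceeds the preceding even one by the
  single term \<open>a n\<close>, which tends to zero.\<close>

lemma sums_interleave:
  fixes a b :: "nat \<Rightarrow> 'a::real_normed_vector"
  assumes "a sums s" "b sums t"
  shows "interleave a b sums (s + t)"
  unfolding sums_def
proof (rule limseq_even_odd)
  have even: "(\<Sum>i<2 * n. interleave a b i) = (\<Sum>i<n. a i) + (\<Sum>i<n. b i)" for n
    by (induction n) (simp_all add: interleave_def)
  show lim: "(\<lambda>n. \<Sum>i<2 * n. interleave a b i) \<longlonglongrightarrow> s + t"
    unfolding even using assms by (intro tendsto_add) (simp_all add: sums_def)
  have "a \<longlonglongrightarrow> 0"
    using assms(1) by (intro summable_LIMSEQ_zero sums_summable)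
  from tendsto_add[OF lim this]
  show "(\<lambda>n. \<Sum>i<2 * n + 1. interleave a b i) \<longlonglongrightarrow> s + t"
    by (simp add: interleave_def)
qed

text \<open>The inverse root is \<open>S\<close> composed with the inverse of \<open>A\<close>,
  since \<open>S (S (?T w)) = w\<close>. Symmetry of \<open>S\<close> then gives the last identity,
  which turns the trace of the inverse into a Hilbert-Schmidt norm of \<open>R\<close>.\<close>

lemma op_sqrt_inverse:
  fixes D V :: "'u::{real_inner, polish_space} set"
  assumes A: "self_adjoint_op D A" and m: "m > 0" "\<forall>u\<in>D. A u \<bullet> u \<ge> m * (norm u)\<^sup>2"
    and S: "is_op_sqrt V S D A"
  defines "R \<equiv> the_inv_into V S"
  shows "\<And>v. v \<in> V \<Longrightarrow> R (S v) = v"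
    and "bounded_linear R"
    and "\<And>w. (norm (R w))\<^sup>2 = w \<bullet> the_inv_into D A w"
proof -
  let ?T = "the_inv_into D A"
  have bij: "bij_betw A D UNIV"
    using self_adjoint_op_coercive_bij[OF A m] .
  have T: "?T w \<in> D" "A (?T w) = w" for w
    using bij the_inv_into_into[of A D w D] f_the_inv_into_f[of A D w] by (auto simp: bij_betw_def)
  have saS: "self_adjoint_op V S" and D: "D = {u \<in> V. S u \<in> V}" and AS: "\<And>u. u \<in> D \<Longrightarrow> A u = S (S u)"
    using S by (auto simp: is_op_sqrt_def)
  have lin: "linear_op V S" using saS by (simp add: self_adjoint_op_def)
  then have V: "subspace V" by (simp add: linear_op_def)
  have ST: "S (?T w) \<in> V" "S (S (?T w)) = w" "?T w \<in> V" for w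
    using T[of w] AS[of "?T w"] D by auto
  have inj: "inj_on S V"
  proof (rule inj_onI)
    fix x y assume xy: "x \<in> V" "y \<in> V" "S x = S y"
    let ?z = "x - y"
    have z: "?z \<in> V" "S ?z = 0"
      using xy V linear_op_diff[OF lin xy(1,2)] by (auto simp: subspace_diff)
    have "?z \<bullet> ?z = ?z \<bullet> S (S (?T ?z))" by (simp add: ST)
    also have "\<dots> = S ?z \<bullet> S (?T ?z)"
      using self_adjoint_op_symmetric[OF saS z(1) ST(1)] by simp
    finally show "x = y" using z(2) by simp
  qed
  have R: "R w = S (?T w)" for w
    unfolding R_def using the_inv_into_f_eq[OF inj ST(2) ST(1)] .
  show RS: "R (S v) = v" if "v \<in> V" for v
    unfolding R_def using the_inv_into_f_f[OF inj that] .
  show norm_R: "(norm (R w))\<^sup>2 = w \<bullet> ?T w" for w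
    using self_adjoint_op_symmetric[OF saS ST(1)[of w] ST(3)[of w]] ST(2)[of w]
    unfolding R power2_norm_eq_inner by simp
  show "bounded_linear R"
  proof (rule bounded_linear_intro)
    fix x y c
    have "R x + R y \<in> V" "S (R x + R y) = x + y"
      using ST V lin unfolding R linear_op_def by (auto simp: subspace_add)
    then show "R (x + y) = R x + R y" using RS by metis
    have "c *\<^sub>R R x \<in> V" "S (c *\<^sub>R R x) = c *\<^sub>R x"
      using ST V lin unfolding R linear_op_def by (auto simp: subspace_scale)
    then show "R (c *\<^sub>R x) = c *\<^sub>R R x" using RS by metis
    have "m * norm (?T x) \<le> norm x"
      using coercive_lower_bound[of m "?T x" A] bspec[OF m(2) T(1)[of x]] T(2)[of x] by simp
    then have "norm (?T x) \<le> norm x / m"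
      using m(1) by (simp add: field_simps)
    then have "norm x * norm (?T x) \<le> norm x * (norm x / m)"
      by (rule mult_left_mono) simp
    \<comment> \<open>The inverse of \<open>A\<close> has norm at most \<open>1 / m\<close>, so its
      square root has norm at most \<open>sqrt (1 / m)\<close>.\<close>
    also have "norm x * (norm x / m) = (norm x * sqrt (1 / m))\<^sup>2"
      using m(1) unfolding power_mult_distrib by (subst real_sqrt_pow2) (simp_all add: power2_eq_square)
    finally have "(norm (R x))\<^sup>2 \<le> (norm x * sqrt (1 / m))\<^sup>2"
      using norm_cauchy_schwarz[of x "?T x"] unfolding norm_R by linarith
    then show "norm (R x) \<le> norm x * sqrt (1 / m)"
      by (rule power2_le_imp_le) (use m(1) in simp)
  qed
qed


section \<open>Interpolation\<close>

lemma K_norm_nonneg: "0 \<le> K_norm S k"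
  by (simp add: K_norm_def)

text \<open>Ensures that the supremum in \<open>K_opnorm\<close> is not taken over the empty set,
  where its value would carry no meaning.\<close>

lemma zero_in_K_ball:
  fixes S :: "'u::real_normed_vector \<Rightarrow> 'u"
  assumes "linear_op V S"
  shows "0 \<in> {k \<in> K_space V. K_norm S k \<le> 1}"
proof -
  have "0 \<in> V" using assms by (simp add: linear_op_def subspace_0)
  moreover have "S (0 *\<^sub>R 0) = 0 *\<^sub>R S 0"
    using assms \<open>0 \<in> V\<close> unfolding linear_op_def by blast
  ultimately show ?thesis by (simp add: K_space_def K_norm_def mem_Times_iff)
qed

lemma K_opnorm_le:
  fixes S :: "'u::real_normed_vector \<Rightarrow> 'u"
  assumes "linear_op V S" "0 \<le> M" "\<And>k. k \<in> K_space V \<Longrightarrow> norm (T k) \<le> M * K_norm S k"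
  shows "K_opnorm V S T \<le> M"
  unfolding K_opnorm_def
proof (rule cSUP_least)
  fix k assume k: "k \<in> {k \<in> K_space V. K_norm S k \<le> 1}"
  then have "M * K_norm S k \<le> M * 1"
    using assms(2) by (intro mult_left_mono) auto
  then show "norm (T k) \<le> M" using assms(3)[of k] k by simp
qed (use zero_in_K_ball[OF assms(1)] in blast)

lemma K_opnorm_nonneg:
  fixes S :: "'u::real_normed_vector \<Rightarrow> 'u"
  assumes S: "linear_op V S" and T: "K_bounded_linear V S T"
  shows "0 \<le> K_opnorm V S T"
proof -
  obtain C where C: "\<And>k. k \<in> K_space V \<Longrightarrow> norm (T k) \<le> C * K_norm S k"
    using T unfolding K_bounded_linear_def by blast
  have "norm (T k) \<le> \<bar>C\<bar>" if "k \<in> {k \<in> K_space V. K_norm S k \<le> 1}" for k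
  proof -
    have "C * K_norm S k \<le> \<bar>C\<bar> * 1"
      using that K_norm_nonneg[of S k] by (intro mult_mono) auto
    then show ?thesis using C[of k] that by simp
  qed
  then have "bdd_above ((\<lambda>k. norm (T k)) ` {k \<in> K_space V. K_norm S k \<le> 1})"
    by (rule bdd_aboveI2)
  from cSUP_upper2[OF this zero_in_K_ball[OF S], of 0] show ?thesis
    by (simp add: K_opnorm_def)
qed

lemma sup_norm_le: "(\<And>x. norm (f x) \<le> M) \<Longrightarrow> sup_norm f \<le> M"
  unfolding sup_norm_def by (rule cSUP_least) auto

lemma norm_le_sup_norm:
  assumes "f \<in> Cb"
  shows "norm (f x) \<le> sup_norm f"
  using assms unfolding sup_norm_def Cb_def
  by (intro cSUP_upper) (auto simp: bounded_iff bdd_above_def)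

lemma sup_norm_nonneg: "f \<in> Cb \<Longrightarrow> 0 \<le> sup_norm f"
  by (rule order_trans[OF norm_ge_zero norm_le_sup_norm])

lemma C1K_norm_nonneg:
  assumes S: "linear_op V S" and F: "F \<in> C1K V S \<iota>"
  shows "0 \<le> C1K_norm V S \<iota> F"
proof -
  have "0 \<le> K_opnorm V S (K_grad \<iota> F 0)"
    using F unfolding C1K_def K_differentiable_def by (blast intro: K_opnorm_nonneg[OF S])
  also have "\<dots> \<le> (SUP x. K_opnorm V S (K_grad \<iota> F x))"
    using F by (intro cSUP_upper) (auto simp: C1K_def)
  finally show ?thesis
    using F sup_norm_nonneg[of F] by (simp add: C1K_def C1K_norm_def)
qed

text \<open>An infimum of reals lies below its members only if the set is bounded below;
  nonnegativity of both norms supplies the bound 0.\<close>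

lemma interp_L_le:
  assumes S: "linear_op V S" and t: "0 < t" and ab: "a \<in> Cb" "b \<in> C1K V S \<iota>"
  shows "interp_L V S \<iota> t (\<lambda>x. a x + b x) \<le> sup_norm a + t * C1K_norm V S \<iota> b"
  unfolding interp_L_def
proof (rule cInf_lower)
  show "bdd_below {sup_norm a' + t * C1K_norm V S \<iota> b' |a' b'.
      (\<lambda>x. a x + b x) = (\<lambda>x. a' x + b' x) \<and> a' \<in> Cb \<and> b' \<in> C1K V S \<iota>}"
    by (rule bdd_belowI[of _ 0]) (use t in \<open>auto intro!: add_nonneg_nonneg mult_nonneg_nonneg sup_norm_nonneg C1K_norm_nonneg[OF S]\<close>)
qed (use ab in blast)

lemma Cb_holder_bound:
  assumes "f \<in> Cb_holder \<alpha>"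
  shows "norm (f x - f y) \<le> (SUP p. holder_quot \<alpha> f p) * dist x y powr \<alpha>"
    and "0 \<le> (SUP p. holder_quot \<alpha> f p)"
proof -
  have bdd: "bdd_above (range (holder_quot \<alpha> f))"
    using assms by (simp add: Cb_holder_def)
  have "holder_quot \<alpha> f (x, y) \<le> (SUP p. holder_quot \<alpha> f p)"
    by (rule cSUP_upper[OF UNIV_I bdd])
  then show "norm (f x - f y) \<le> (SUP p. holder_quot \<alpha> f p) * dist x y powr \<alpha>"
    by (cases "x = y") (simp_all add: holder_quot_def pos_divide_le_eq)
  have "0 \<le> holder_quot \<alpha> f (x, y)" by (simp add: holder_quot_def)
  also have "\<dots> \<le> (SUP p. holder_quot \<alpha> f p)"
    by (rule cSUP_upper[OF UNIV_I bdd])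
  finally show "0 \<le> (SUP p. holder_quot \<alpha> f p)" .
qed

text \<open>
  The family \<open>e\<close> plays the role of an orthonormal basis of \<open>K\<close>, seen in \<open>H\<close>, and \<open>c\<close> of the
  coordinates in this basis; summability of \<open>\<parallel>e i\<parallel>\<^sup>2\<close> says that the embedding of \<open>K\<close> in \<open>H\<close> is
  Hilbert--Schmidt.
\<close>

locale K_frame =
  fixes V :: "'u::{real_inner, second_countable_topology} set" and S :: "'u \<Rightarrow> 'u"
    and \<iota> :: "'u \<Rightarrow> 'w::{real_inner, second_countable_topology}"
    and e :: "nat \<Rightarrow> 'u \<times> 'w" and c :: "'u \<times> 'u \<Rightarrow> nat \<Rightarrow> real"
  assumes S_lin: "linear_op V S"
    and e_summable: "summable (\<lambda>i. (norm (e i))\<^sup>2)"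
    and c_add: "\<And>k k' i. k \<in> K_space V \<Longrightarrow> k' \<in> K_space V \<Longrightarrow> c (k + k') i = c k i + c k' i"
    and c_scale: "\<And>r k i. k \<in> K_space V \<Longrightarrow> c (r *\<^sub>R k) i = r * c k i"
    and c_summable: "\<And>k. k \<in> K_space V \<Longrightarrow> summable (\<lambda>i. (c k i)\<^sup>2)"
    and c_le: "\<And>k. k \<in> K_space V \<Longrightarrow> (\<Sum>i. (c k i)\<^sup>2) \<le> (K_norm S k)\<^sup>2"
    and c_sums: "\<And>k. k \<in> K_space V \<Longrightarrow> (\<lambda>i. c k i *\<^sub>R e i) sums K_emb \<iota> k"
begin

text \<open>Squared Hilbert-Schmidt norm of the embedding in the intended application, and the
  limiting second moment of the displacement at unit scale.\<close>

definition "\<sigma> = (\<Sum>i. (norm (e i))\<^sup>2)"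

lemma \<sigma>_nonneg: "0 \<le> \<sigma>"
  unfolding \<sigma>_def using e_summable by (intro suminf_nonneg) auto

lemma subspace_K: "subspace (K_space V)"
  using S_lin unfolding linear_op_def K_space_def
  by (auto simp: subspace_def zero_prod_def)

context
  fixes f :: "'u \<times> 'w \<Rightarrow> 'j::{real_inner, polish_space}" and t L \<alpha> :: real
  assumes f: "f \<in> Cb" and t: "0 < t" and \<alpha>: "0 < \<alpha>" "\<alpha> < 1"
    and holder: "\<And>x y. norm (f x - f y) \<le> L * dist x y powr \<alpha>" and L: "0 \<le> L"
begin

text \<open>The parameter \<open>t\<close> is absorbed into the frame; coordinates then scale by
  \<open>1 / t\<close>, which is the price of one derivative.\<close>

definition "te = (\<lambda>i. t *\<^sub>R e i)"
definition "ct k = (\<lambda>i. c k i / t)"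
definition "M = L * t powr \<alpha> * sqrt (1 + \<sigma>) / t"
abbreviation "b \<equiv> smooth te f"
abbreviation "G x k \<equiv> smooth_deriv te f x (ct k)"

lemma f_unif: "uniformly_continuous_on UNIV f"
  using f by (simp add: Cb_def)

lemma
  shows te_summable: "summable (\<lambda>i. (norm (te i))\<^sup>2)"
    and te_suminf: "(\<Sum>i. (norm (te i))\<^sup>2) / t\<^sup>2 = \<sigma>"
proof -
  have eq: "(norm (te i))\<^sup>2 = t\<^sup>2 * (norm (e i))\<^sup>2" for i
    by (simp add: te_def power_mult_distrib)
  show "summable (\<lambda>i. (norm (te i))\<^sup>2)"
    unfolding eq by (rule summable_mult[OF e_summable])
  show "(\<Sum>i. (norm (te i))\<^sup>2) / t\<^sup>2 = \<sigma>"
    unfolding eq suminf_mult[OF e_summable] \<sigma>_def using t by simp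
qed

lemmas smooth_facts = f_unif norm_le_sup_norm[OF f] te_summable

context
  fixes k assumes k: "k \<in> K_space V"
begin

lemma
  shows ct_summable: "summable (\<lambda>i. (ct k i)\<^sup>2)"
    and sqrt_ct_le: "sqrt (\<Sum>i. (ct k i)\<^sup>2) \<le> K_norm S k / t"
proof -
  have eq: "(ct k i)\<^sup>2 = (c k i)\<^sup>2 / t\<^sup>2" for i
    by (simp add: ct_def power_divide)
  show "summable (\<lambda>i. (ct k i)\<^sup>2)"
    unfolding eq by (rule summable_divide[OF c_summable[OF k]])
  have "(\<Sum>i. (ct k i)\<^sup>2) \<le> (K_norm S k / t)\<^sup>2"
    unfolding eq suminf_divide[OF c_summable[OF k]] power_divide
    by (rule divide_right_mono[OF c_le[OF k]]) simp
  then show "sqrt (\<Sum>i. (ct k i)\<^sup>2) \<le> K_norm S k / t"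
    using t K_norm_nonneg[of S k] by (intro real_le_lsqrt) auto
qed

lemma ct_sums: "(\<lambda>i. ct k i *\<^sub>R te i) sums K_emb \<iota> k"
  using c_sums[OF k] t by (simp add: ct_def te_def)

text \<open>The remainder for the step \<open>s *\<^sub>R K_emb \<iota> k\<close> is quadratic in
  \<open>s\<close>; one power is spent on the division.\<close>

lemma K_quot_smooth_le:
  fixes s :: real
  assumes s: "s \<noteq> 0" "s\<^sup>2 * (\<Sum>i. (ct k i)\<^sup>2) \<le> 1"
  shows "norm (K_quot \<iota> b x k s - G x k) \<le> sup_norm f * (\<Sum>i. (ct k i)\<^sup>2) * \<bar>s\<bar>"
proof -
  let ?c = "\<Sum>i. (ct k i)\<^sup>2"
  have sm: "summable (\<lambda>i. (s * ct k i)\<^sup>2)"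
    unfolding power_mult_distrib by (rule summable_mult[OF ct_summable])
  have sq: "(\<Sum>i. (s * ct k i)\<^sup>2) = s\<^sup>2 * ?c"
    unfolding power_mult_distrib by (rule suminf_mult[OF ct_summable])
  have ss: "(\<lambda>i. (s * ct k i) *\<^sub>R te i) sums (s *\<^sub>R K_emb \<iota> k)"
    using sums_scaleR_right[OF ct_sums, of s] by simp
  have rem: "norm (b (x + s *\<^sub>R K_emb \<iota> k) - b x - s *\<^sub>R G x k) \<le> sup_norm f * (s\<^sup>2 * ?c)"
    using smooth_remainder[OF smooth_facts sm ss] s(2)
    unfolding sq smooth_deriv_scale[OF smooth_facts ct_summable ct_sums] .
  have "K_quot \<iota> b x k s - G x k = (b (x + s *\<^sub>R K_emb \<iota> k) - b x - s *\<^sub>R G x k) /\<^sub>R s"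
    using s(1) by (simp add: K_quot_def scaleR_diff_right)
  then have "norm (K_quot \<iota> b x k s - G x k) = norm (b (x + s *\<^sub>R K_emb \<iota> k) - b x - s *\<^sub>R G x k) / \<bar>s\<bar>"
    by (simp add: divide_inverse mult.commute)
  also have "\<dots> \<le> (sup_norm f * (s\<^sup>2 * ?c)) / \<bar>s\<bar>"
    by (rule divide_right_mono[OF rem]) simp
  also have "\<dots> = sup_norm f * ?c * \<bar>s\<bar>"
    using s(1) by (simp add: field_simps power2_eq_square)
  finally show ?thesis .
qed

lemma K_quot_smooth_tendsto: "(K_quot \<iota> b x k \<longlongrightarrow> G x k) (at 0)"
proof -
  let ?c = "\<Sum>i. (ct k i)\<^sup>2"
  have c: "0 \<le> ?c" by (intro suminf_nonneg ct_summable) simp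
  have "((\<lambda>s. s\<^sup>2 * ?c) \<longlongrightarrow> 0\<^sup>2 * ?c) (at 0)"
    by (intro tendsto_intros)
  then have "eventually (\<lambda>s. s\<^sup>2 * ?c < 1) (at 0)"
    by (rule order_tendstoD) simp
  then have "eventually (\<lambda>s. norm (K_quot \<iota> b x k s - G x k) \<le> sup_norm f * ?c * \<bar>s\<bar>) (at 0)"
    using eventually_at_filter[of "\<lambda>s. s \<noteq> 0" "0::real" UNIV]
    by (auto elim!: eventually_elim2[of "\<lambda>s. s \<noteq> 0" "at 0"] intro: K_quot_smooth_le)
  moreover have "((\<lambda>s. sup_norm f * ?c * \<bar>s\<bar>) \<longlongrightarrow> 0) (at (0::real))"
    by (rule tendsto_eq_intros refl | simp)+
  ultimately have "((\<lambda>s. K_quot \<iota> b x k s - G x k) \<longlongrightarrow> 0) (at 0)"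
    by (rule Lim_null_comparison)
  then show ?thesis by (rule LIM_zero_cancel)
qed

lemma K_grad_smooth: "K_grad \<iota> b x k = G x k"
  unfolding K_grad_def by (rule tendsto_Lim[OF _ K_quot_smooth_tendsto]) simp

lemma norm_K_grad_smooth_le: "norm (K_grad \<iota> b x k) \<le> M * K_norm S k"
proof -
  have "norm (K_grad \<iota> b x k) \<le> L * t powr \<alpha> * (sqrt (\<Sum>i. (ct k i)\<^sup>2) * sqrt (1 + \<sigma>))"
    using norm_smooth_deriv_le[OF smooth_facts ct_summable ct_sums \<alpha> holder L t, of x]
    unfolding te_suminf K_grad_smooth .
  also have "\<dots> \<le> L * t powr \<alpha> * (K_norm S k / t * sqrt (1 + \<sigma>))"
    using L \<sigma>_nonneg by (intro mult_left_mono mult_right_mono sqrt_ct_le) auto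
  finally show ?thesis by (simp add: M_def mult_ac)
qed

lemma norm_K_grad_smooth_diff_le:
  assumes "\<And>z. norm (f (x + z) - f (y + z)) \<le> d"
  shows "norm (K_grad \<iota> b x k - K_grad \<iota> b y k) \<le> d / t * K_norm S k"
proof -
  have d: "0 \<le> d" using order_trans[OF norm_ge_zero assms] .
  have "norm (K_grad \<iota> b x k - K_grad \<iota> b y k) \<le> d * sqrt (\<Sum>i. (ct k i)\<^sup>2)"
    unfolding K_grad_smooth
    by (rule smooth_deriv_diff_le[OF smooth_facts ct_summable ct_sums assms])
  also have "\<dots> \<le> d * (K_norm S k / t)"
    by (rule mult_left_mono[OF sqrt_ct_le d])
  finally show ?thesis by simp
qed

end

lemma M_nonneg: "0 \<le> M"
  using L t \<sigma>_nonneg by (simp add: M_def)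

lemma linear_op_K_grad_smooth: "linear_op (K_space V) (K_grad \<iota> b x)"
  unfolding linear_op_def
proof (intro conjI ballI allI)
  fix k k' assume k: "k \<in> K_space V" "k' \<in> K_space V"
  then have "ct (k + k') = (\<lambda>i. ct k i + ct k' i)"
    by (simp add: ct_def c_add add_divide_distrib)
  then show "K_grad \<iota> b x (k + k') = K_grad \<iota> b x k + K_grad \<iota> b x k'"
    using smooth_deriv_add[OF smooth_facts ct_summable[OF k(1)] ct_sums[OF k(1)] ct_summable[OF k(2)] ct_sums[OF k(2)]] k
    by (simp add: K_grad_smooth subspace_K subspace_add)
next
  fix r k assume k: "k \<in> K_space V"
  then have "ct (r *\<^sub>R k) = (\<lambda>i. r * ct k i)"
    by (simp add: ct_def c_scale)
  then show "K_grad \<iota> b x (r *\<^sub>R k) = r *\<^sub>R K_grad \<iota> b x k"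
    using smooth_deriv_scale[OF smooth_facts ct_summable[OF k] ct_sums[OF k]] k
    by (simp add: K_grad_smooth subspace_K subspace_scale)
qed (rule subspace_K)

lemma smooth_in_Cb: "b \<in> Cb"
  using norm_smooth_le[OF smooth_facts] smooth_unif[OF smooth_facts]
  by (auto simp: Cb_def bounded_iff)

lemma K_opnorm_smooth_le: "K_opnorm V S (K_grad \<iota> b x) \<le> M"
  by (rule K_opnorm_le[OF S_lin M_nonneg norm_K_grad_smooth_le])

lemma smooth_in_C1K: "b \<in> C1K V S \<iota>"
  unfolding C1K_def
proof (intro CollectI conjI allI impI)
  show "b \<in> Cb" by (rule smooth_in_Cb)
  show "K_differentiable V S \<iota> b"
    unfolding K_differentiable_def K_bounded_linear_def
    using K_quot_smooth_tendsto linear_op_K_grad_smooth norm_K_grad_smooth_le by blast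
  show "bdd_above (range (\<lambda>x. K_opnorm V S (K_grad \<iota> b x)))"
    by (rule bdd_aboveI2) (rule K_opnorm_smooth_le)
  fix \<epsilon> :: real assume \<epsilon>: "\<epsilon> > 0"
  \<comment> \<open>The factor \<open>t\<close> cancels the \<open>1 / t\<close> of the gradient
    estimate, and the half leaves room for the strict inequality after passing to the
    supremum.\<close>
  then have "\<epsilon> / 2 * t > 0" using t by simp
  then obtain \<delta> where \<delta>: "\<delta> > 0" "\<And>x y. dist x y < \<delta> \<Longrightarrow> norm (f x - f y) \<le> \<epsilon> / 2 * t"
    using f_modulus[OF smooth_facts, of "\<epsilon> / 2 * t"] by blast
  have "K_opnorm V S (\<lambda>k. K_grad \<iota> b x k - K_grad \<iota> b y k) < \<epsilon>" if "dist x y < \<delta>" for x y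
  proof -
    have "norm (f (x + z) - f (y + z)) \<le> \<epsilon> / 2 * t" for z
      by (rule \<delta>(2)) (use that in \<open>simp add: dist_norm\<close>)
    from norm_K_grad_smooth_diff_le[OF _ this]
    have "K_opnorm V S (\<lambda>k. K_grad \<iota> b x k - K_grad \<iota> b y k) \<le> \<epsilon> / 2"
      using \<epsilon> t by (intro K_opnorm_le[OF S_lin]) auto
    then show ?thesis using \<epsilon> by simp
  qed
  with \<delta>(1) show "\<exists>\<delta>>0. \<forall>x y. dist x y < \<delta> \<longrightarrow> K_opnorm V S (\<lambda>k. K_grad \<iota> b x k - K_grad \<iota> b y k) < \<epsilon>"
    by blast
qed

lemma C1K_norm_smooth_le: "C1K_norm V S \<iota> b \<le> sup_norm f + M"
  unfolding C1K_norm_def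
  by (intro add_mono sup_norm_le norm_smooth_le[OF smooth_facts] cSUP_least K_opnorm_smooth_le) auto

text \<open>The decomposition is \<open>f - b\<close> plus \<open>b\<close>, with the free length
  \<tau> of the estimates taken equal to \<open>t\<close>.\<close>

lemma interp_L_smooth_le:
  "interp_L V S \<iota> t f \<le> L * t powr \<alpha> * (1 + \<sigma>) + t * (sup_norm f + M)"
proof -
  let ?a = "\<lambda>x. f x - b x"
  have "norm (?a x) \<le> L * t powr \<alpha> * (1 + \<sigma>)" for x
    using smooth_approx[OF smooth_facts \<alpha> holder L t, of x] unfolding te_suminf .
  moreover from this have "?a \<in> Cb"
    using f_unif smooth_unif[OF smooth_facts] uniformly_continuous_on_diff[of UNIV f b]
    by (auto simp: Cb_def bounded_iff)
  ultimately have "interp_L V S \<iota> t (\<lambda>x. ?a x + b x) \<le> L * t powr \<alpha> * (1 + \<sigma>) + t * (sup_norm f + M)"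
    using t by (intro order_trans[OF interp_L_le[OF S_lin t _ smooth_in_C1K]] add_mono sup_norm_le
        mult_left_mono C1K_norm_smooth_le) auto
  then show ?thesis by simp
qed

lemma interp_L_scaled_le:
  assumes "t \<le> 1"
  shows "t powr (-\<alpha>) * interp_L V S \<iota> t f \<le> 2 * (1 + \<sigma>) * (sup_norm f + L)"
proof -
  have B: "0 \<le> sup_norm f" by (rule sup_norm_nonneg[OF f])
  have tt: "t powr (-\<alpha>) * t powr \<alpha> = 1"
    using t by (simp flip: powr_add)
  \<comment> \<open>Weight of \<open>sup_norm f\<close> in the norm of \<open>b\<close>; here
    \<open>t \<le> 1\<close> enters.\<close>
  have "t powr (-\<alpha>) * t = t powr (1 - \<alpha>)"
    using t by (simp add: powr_diff powr_minus field_simps)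
  also have "\<dots> \<le> 1"
    using assms t \<alpha> by (intro powr_le1) auto
  finally have t1: "t powr (-\<alpha>) * t \<le> 1" .
  have "t powr (-\<alpha>) * interp_L V S \<iota> t f
      \<le> t powr (-\<alpha>) * (L * t powr \<alpha> * (1 + \<sigma>) + t * (sup_norm f + M))"
    by (intro mult_left_mono interp_L_smooth_le) simp
  also have "\<dots> = (t powr (-\<alpha>) * t powr \<alpha>) * (L * (1 + \<sigma>)) + (t powr (-\<alpha>) * t) * sup_norm f
      + (t powr (-\<alpha>) * t powr \<alpha>) * (L * sqrt (1 + \<sigma>))"
    using t by (simp add: M_def field_simps)
  \<comment> \<open>Approximation error and gradient each contribute \<open>L\<close> times at most
    \<open>1 + \<sigma>\<close>, which is the source of the factor 2.\<close>
  also have "\<dots> \<le> L * (1 + \<sigma>) + 1 * sup_norm f + L * (1 + \<sigma>)"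
    unfolding tt mult_1_left
  proof (intro add_mono mult_right_mono t1 B mult_left_mono L order_refl)
    show "sqrt (1 + \<sigma>) \<le> 1 + \<sigma>"
      using \<sigma>_nonneg by (intro real_le_lsqrt) (auto simp: power2_eq_square algebra_simps)
    show "t powr - \<alpha> * t * sup_norm f \<le> sup_norm f"
      using mult_right_mono[OF t1 B] by simp
  qed (use \<sigma>_nonneg in simp)
  also have "\<dots> \<le> 2 * (1 + \<sigma>) * (sup_norm f + L)"
    using B \<sigma>_nonneg mult_nonneg_nonneg[OF \<sigma>_nonneg B] by (simp add: algebra_simps)
  finally show ?thesis .
qed

end

theorem holder_continuously_included:
  assumes \<alpha>: "0 < \<alpha>" "\<alpha> < 1"
  shows "continuously_included
    (Cb_holder \<alpha> :: ('u \<times> 'w \<Rightarrow> 'j::{real_inner, polish_space}) set) (holder_norm \<alpha>)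
    (interp_space V S \<iota> \<alpha>) (interp_norm V S \<iota> \<alpha>)"
proof -
  let ?C = "2 * (1 + \<sigma>)"
  have bound: "t powr (-\<alpha>) * interp_L V S \<iota> t f \<le> ?C * holder_norm \<alpha> f"
    if f: "f \<in> Cb_holder \<alpha>" and t: "t \<in> {0<..1}" for f :: "'u \<times> 'w \<Rightarrow> 'j" and t
  proof -
    have "f \<in> Cb" using f by (simp add: Cb_holder_def)
    with t show ?thesis
      using interp_L_scaled_le[of f t \<alpha> "SUP p. holder_quot \<alpha> f p"] \<alpha> Cb_holder_bound[OF f]
      by (simp add: holder_norm_def)
  qed
  have "f \<in> interp_space V S \<iota> \<alpha>" if "f \<in> Cb_holder \<alpha>" for f :: "'u \<times> 'w \<Rightarrow> 'j"
  proof -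
    have "bdd_above ((\<lambda>t. t powr (-\<alpha>) * interp_L V S \<iota> t f) ` {0<..1})"
      by (rule bdd_aboveI2) (rule bound[OF that])
    with that show ?thesis by (simp add: interp_space_def Cb_holder_def)
  qed
  moreover have "interp_norm V S \<iota> \<alpha> f \<le> ?C * holder_norm \<alpha> f" if "f \<in> Cb_holder \<alpha>" for f :: "'u \<times> 'w \<Rightarrow> 'j"
    unfolding interp_norm_def by (rule cSUP_least) (use bound[OF that] in auto)
  ultimately show ?thesis
    unfolding continuously_included_def by blast
qed

end

section \<open>The frame of K built from an orthonormal basis of U\<close>

theorem lemma4p4:
  fixes D V :: "'u::{real_inner, polish_space} set"
    and \<Lambda> S :: "'u \<Rightarrow> 'u"
    and \<iota> :: "'u \<Rightarrow> 'w::{real_inner, polish_space}"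
    and \<alpha> :: real
  assumes "self_adjoint_op D \<Lambda>"
    and "\<exists>m>0. \<forall>u\<in>D. \<Lambda> u \<bullet> u \<ge> m * (norm u)\<^sup>2"
    and "trace_class_op (the_inv_into D \<Lambda>)"
    and "is_op_sqrt V S D \<Lambda>"
    and "is_completion (\<lambda>u v. the_inv_into V S u \<bullet> the_inv_into V S v) \<iota>"
    and "0 < \<alpha>" and "\<alpha> < 1"
  shows "continuously_included
           (Cb_holder \<alpha> :: ('u \<times> 'w \<Rightarrow> 'j::{real_inner, polish_space}) set) (holder_norm \<alpha>)
           (interp_space V S \<iota> \<alpha>) (interp_norm V S \<iota> \<alpha>)"
proof -
  let ?R = "the_inv_into V S" and ?T = "the_inv_into D \<Lambda>"
  obtain m where m: "m > 0" "\<forall>u\<in>D. \<Lambda> u \<bullet> u \<ge> m * (norm u)\<^sup>2"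
    using assms(2) by blast
  note R = op_sqrt_inverse[OF assms(1) m assms(4)]
  have S_lin: "linear_op V S"
    using assms(4) by (simp add: is_op_sqrt_def self_adjoint_op_def)
  have \<iota>: "linear \<iota>" "\<And>u. norm (\<iota> u) = norm (?R u)"
    using assms(5) by (auto simp: is_completion_def norm_eq_sqrt_inner)
  have \<iota>_bl: "bounded_linear \<iota>"
  proof -
    obtain C where "\<And>x. norm (?R x) \<le> norm x * C"
      using R(2) bounded_linear.bounded by blast
    with \<iota> show ?thesis
      by (intro bounded_linear_intro[of \<iota> C]) (auto simp: linear_add linear_scale)
  qed
  obtain g :: "nat \<Rightarrow> 'u" where g: "orthonormal0 g" "\<And>x. (\<lambda>i. (x \<bullet> g i) *\<^sub>R g i) sums x"
    using ex_orthonormal0_basis by blast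
  \<comment> \<open>The squares are \<open>g i \<bullet> ?T (g i)\<close>, the terms of the
    trace.\<close>
  have HS: "summable (\<lambda>i. (norm (?R (g i)))\<^sup>2)"
    unfolding R(3) by (rule trace_class_op_summable[OF assms(3) g(1)]) (simp flip: R(3))
  \<comment> \<open>As \<open>S\<close> carries the inner product of V to that of U, the
    \<open>?R (g i)\<close> form a basis of V (zero vectors allowed). The \<open>g i\<close>
    themselves serve the second component, where \<iota> gives them the norm of
    \<open>?R (g i)\<close>: both halves have the same square sum.\<close>
  define e :: "nat \<Rightarrow> 'u \<times> 'w" where
    "e = interleave (\<lambda>i. (?R (g i), 0)) (\<lambda>i. (0, \<iota> (g i)))"
  \<comment> \<open>The coordinate of \<open>v\<close> in V against \<open>?R (g i)\<close> is
    \<open>S v \<bullet> S (?R (g i))\<close>, that is \<open>S v \<bullet> g i\<close>.\<close>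
  define c :: "'u \<times> 'u \<Rightarrow> nat \<Rightarrow> real" where
    "c k = interleave (\<lambda>i. S (fst k) \<bullet> g i) (\<lambda>i. snd k \<bullet> g i)" for k
  have interleave_map: "(\<lambda>i. F (interleave a b i)) = interleave (\<lambda>i. F (a i)) (\<lambda>i. F (b i))"
    for F :: "'x \<Rightarrow> 'y" and a b
    by (auto simp: interleave_def)
  have c_sq: "(\<lambda>i. (c k i)\<^sup>2) sums ((\<Sum>i. (S (fst k) \<bullet> g i)\<^sup>2) + (\<Sum>i. (snd k \<bullet> g i)\<^sup>2))" for k
    unfolding c_def interleave_map[of "\<lambda>x. x\<^sup>2"]
    by (intro sums_interleave summable_sums orthonormal0_bessel_summable[OF g(1)])
  interpret K_frame V S \<iota> e c
  proof
    show "linear_op V S" by (rule S_lin)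
    have "interleave (\<lambda>i. (norm (?R (g i)))\<^sup>2) (\<lambda>i. (norm (?R (g i)))\<^sup>2) sums
        ((\<Sum>i. (norm (?R (g i)))\<^sup>2) + (\<Sum>i. (norm (?R (g i)))\<^sup>2))"
      by (intro sums_interleave summable_sums HS)
    then show "summable (\<lambda>i. (norm (e i))\<^sup>2)"
      unfolding e_def interleave_map[of "\<lambda>x. (norm x)\<^sup>2"]
      by (simp add: norm_Pair \<iota>(2) sums_iff)
    show "c (k + k') i = c k i + c k' i" if "k \<in> K_space V" "k' \<in> K_space V" for k k' i
      using that S_lin
      by (auto simp: c_def interleave_def K_space_def linear_op_def inner_add_left)
    show "c (r *\<^sub>R k) i = r * c k i" if "k \<in> K_space V" for r k i
      using that S_lin by (auto simp: c_def interleave_def K_space_def linear_op_def)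
    show "summable (\<lambda>i. (c k i)\<^sup>2)" for k
      using c_sq[of k] by (rule sums_summable)
    show "(\<Sum>i. (c k i)\<^sup>2) \<le> (K_norm S k)\<^sup>2" for k
      using orthonormal0_bessel[OF g(1), of "S (fst k)"] orthonormal0_bessel[OF g(1), of "snd k"]
      by (simp add: sums_unique[OF c_sq, symmetric] K_norm_def)
    show "(\<lambda>i. c k i *\<^sub>R e i) sums K_emb \<iota> k" if "k \<in> K_space V" for k
    proof -
      have bl: "bounded_linear (\<lambda>x. (?R x, 0::'w))" "bounded_linear (\<lambda>x. (0::'u, \<iota> x))"
        by (intro bounded_linear_Pair R(2) \<iota>_bl bounded_linear_zero)+
      \<comment> \<open>The expansion of \<open>S (fst k)\<close> in U is mapped by the bounded
        operator \<open>?R\<close>, which returns \<open>fst k\<close>.\<close>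
      have "(\<lambda>i. (S (fst k) \<bullet> g i) *\<^sub>R (?R (g i), 0::'w)) sums (fst k, 0)"
        using bounded_linear.sums[OF bl(1) g(2)[of "S (fst k)"]] R(1)[of "fst k"] that
        by (simp add: linear_simps(5)[OF bl(1)] linear_simps(5)[OF R(2)] K_space_def mem_Times_iff)
      moreover have "(\<lambda>i. (snd k \<bullet> g i) *\<^sub>R (0::'u, \<iota> (g i))) sums (0, \<iota> (snd k))"
        using bounded_linear.sums[OF bl(2) g(2)[of "snd k"]] by (simp add: linear_scale[OF \<iota>(1)])
      ultimately have "interleave (\<lambda>i. (S (fst k) \<bullet> g i) *\<^sub>R (?R (g i), 0)) (\<lambda>i. (snd k \<bullet> g i) *\<^sub>R (0, \<iota> (g i)))
          sums ((fst k, 0) + (0, \<iota> (snd k)))"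
        by (rule sums_interleave)
      moreover have "(\<lambda>i. c k i *\<^sub>R e i)
          = interleave (\<lambda>i. (S (fst k) \<bullet> g i) *\<^sub>R (?R (g i), 0)) (\<lambda>i. (snd k \<bullet> g i) *\<^sub>R (0, \<iota> (g i)))"
        by (auto simp: c_def e_def interleave_def)
      ultimately show ?thesis by (simp add: K_emb_def)
    qed
  qed
  show ?thesis
    by (rule holder_continuously_included[OF assms(6,7)])
qed

end
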